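(* If $G$ is a connected regular simple graph not isomorphic to $K_2$, then $\operatorname{lir}(^2G)\leq 2$.
   Context: All graphs are finite and without loops. A multigraph $M$ consists of a nonempty finite vertex set and a multiset of edges (2-element subsets of the vertex set); the degree of a vertex is the sum of the multiplicities of the edges incident to it. For a simple graph $G$, $^2G$ denotes the 2-multigraph obtained from $G$ by replacing each edge of $G$ with two parallel edges. A multigraph is locally irregular if every two adjacent vertices have different degrees. An edge coloring of a multigraph $M$ assigns a color to each element of the edge multiset (it need not be proper, and parallel edges may receive different colors); it is locally irregular if, for each color, the submultigraph of $M$ induced by the edges of that color is locally irregular. The locally irregular chromatic index $\operatorname{lir}(M)$ is the smallest number of colors in a locally irregular edge coloring of $M$, if one exists; so $\operatorname{lir}(M)\leq k$ means that $M$ has a locally irregular edge coloring using at most $k$ colors. *)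

theory Defs
  imports Main "HOL-Library.Multiset" "HOL-Library.Extended_Nat"
begin

record 'a mgraph =
  verts :: "'a set"
  edges :: "'a set multiset"

definition multigraph :: "'a mgraph \<Rightarrow> bool" where
  "multigraph M \<longleftrightarrow> finite (verts M) \<and> verts M \<noteq> {} \<and>
     (\<forall>e \<in># edges M. e \<subseteq> verts M \<and> card e = 2)"

definition simple_graph :: "'a mgraph \<Rightarrow> bool" where
  "simple_graph G \<longleftrightarrow> multigraph G \<and> (\<forall>e. count (edges G) e \<le> 1)"

definition adjacent :: "'a mgraph \<Rightarrow> 'a \<Rightarrow> 'a \<Rightarrow> bool" where
  "adjacent M u v \<longleftrightarrow> {u, v} \<in># edges M"

definition degree :: "'a mgraph \<Rightarrow> 'a \<Rightarrow> nat" where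
  "degree M v = (\<Sum>e | e \<in># edges M \<and> v \<in> e. count (edges M) e)"

definition regular_graph :: "'a mgraph \<Rightarrow> bool" where
  "regular_graph M \<longleftrightarrow> (\<exists>d. \<forall>v \<in> verts M. degree M v = d)"

definition connected_graph :: "'a mgraph \<Rightarrow> bool" where
  "connected_graph M \<longleftrightarrow> (\<forall>u \<in> verts M. \<forall>v \<in> verts M. (adjacent M)\<^sup>*\<^sup>* u v)"

definition isomorphic :: "'a mgraph \<Rightarrow> 'b mgraph \<Rightarrow> bool" where
  "isomorphic M N \<longleftrightarrow> (\<exists>f. bij_betw f (verts M) (verts N) \<and>
     edges N = image_mset ((`) f) (edges M))"

definition complete_graph :: "nat \<Rightarrow> nat mgraph" where
  "complete_graph n =
     \<lparr>verts = {..<n}, edges = mset_set {e. e \<subseteq> {..<n} \<and> card e = 2}\<rparr>"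

definition doubled :: "'a mgraph \<Rightarrow> 'a mgraph" where
  "doubled G = \<lparr>verts = verts G, edges = edges G + edges G\<rparr>"

definition locally_irregular :: "'a mgraph \<Rightarrow> bool" where
  "locally_irregular M \<longleftrightarrow> (\<forall>u v. adjacent M u v \<longrightarrow> degree M u \<noteq> degree M v)"

text \<open>
  The elements of the edge multiset are made distinguishable by numbering parallel edges:
  the pair \<open>(e, i)\<close> is the \<open>i\<close>-th copy of \<open>e\<close>.  An edge colouring is a function on these pairs;
  its values elsewhere are irrelevant.
\<close>

definition edge_elements :: "'a mgraph \<Rightarrow> ('a set \<times> nat) set" where
  "edge_elements M = {(e, i). i < count (edges M) e}"

definition colour_class :: "'a mgraph \<Rightarrow> ('a set \<times> nat \<Rightarrow> nat) \<Rightarrow> nat \<Rightarrow> 'a mgraph" where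
  "colour_class M c k =
     (let F = image_mset fst (mset_set {x \<in> edge_elements M. c x = k})
      in \<lparr>verts = \<Union>(set_mset F), edges = F\<rparr>)"

definition locally_irregular_colouring ::
    "'a mgraph \<Rightarrow> ('a set \<times> nat \<Rightarrow> nat) \<Rightarrow> bool" where
  "locally_irregular_colouring M c \<longleftrightarrow>
     (\<forall>k \<in> c ` edge_elements M. locally_irregular (colour_class M c k))"

text \<open>The value is \<open>\<infinity>\<close> when no locally irregular edge colouring exists.\<close>

definition lir :: "'a mgraph \<Rightarrow> enat" where
  "lir M = (INF c \<in> {c. locally_irregular_colouring M c}. enat (card (c ` edge_elements M)))"

lemma finite_edge_elements: "finite (edge_elements M)"
proof -
  have "edge_elements M = (SIGMA e : set_mset (edges M). {..<count (edges M) e})"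
    by (auto simp: edge_elements_def simp flip: count_greater_zero_iff)
  then show ?thesis by simp
qed

lemma lir_le_iff:
  "lir M \<le> enat k \<longleftrightarrow>
     (\<exists>c. locally_irregular_colouring M c \<and> card (c ` edge_elements M) \<le> k)"
proof
  assume *: "lir M \<le> enat k"
  let ?A = "(\<lambda>c. enat (card (c ` edge_elements M))) ` {c. locally_irregular_colouring M c}"
  have "?A \<noteq> {}"
  proof
    assume "?A = {}"
    then have "lir M = \<infinity>" unfolding lir_def by (simp only: Inf_enat_def) simp
    with * show False by simp
  qed
  then have "lir M \<in> ?A"
    unfolding lir_def using wellorder_InfI[of _ ?A] by fast
  with * show "\<exists>c. locally_irregular_colouring M c \<and> card (c ` edge_elements M) \<le> k"
    by auto
next
  assume "\<exists>c. locally_irregular_colouring M c \<and> card (c ` edge_elements M) \<le> k"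
  then show "lir M \<le> enat k"
    unfolding lir_def by (auto intro: INF_lower2)
qed

lemma multigraph_doubled: "simple_graph G \<Longrightarrow> multigraph (doubled G)"
  unfolding simple_graph_def multigraph_def doubled_def by simp

lemma edges_colour_class:
  "count (edges (colour_class M c k)) e = card {i. i < count (edges M) e \<and> c (e, i) = k}"
proof -
  let ?S = "{x \<in> edge_elements M. c x = k}"
  have fin: "finite ?S" using finite_edge_elements[of M] by auto
  have "count (edges (colour_class M c k)) e = card (fst -` {e} \<inter> ?S)"
    using fin by (simp add: colour_class_def Let_def count_image_mset)
  also have "fst -` {e} \<inter> ?S = Pair e ` {i. i < count (edges M) e \<and> c (e, i) = k}"
  proof (intro set_eqI)
    fix x
    show "x \<in> fst -` {e} \<inter> ?S \<longleftrightarrow> x \<in> Pair e ` {i. i < count (edges M) e \<and> c (e, i) = k}"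
      by (cases x) (auto simp: edge_elements_def)
  qed
  also have "card \<dots> = card {i. i < count (edges M) e \<and> c (e, i) = k}"
    by (rule card_image) (simp add: inj_on_def)
  finally show ?thesis .
qed

end

theory Submission
  imports Defs "HOL-Number_Theory.Cong"
begin

text \<open>
  Giving an edge \<open>1 + x\<close> red and \<open>1 - x\<close> blue copies, \<open>x \<in> {-1, 0, 1}\<close>, turns the claim for a
  \<open>d\<close>-regular graph into: weight the edges with \<open>-1, 0, 1\<close> such that adjacent vertices have different
  weight sums (``values'').

  Pick a maximal independent set \<open>U\<close> such that the bipartite graph \<open>B\<close> between \<open>U\<close> and its complement
  \<open>R\<close> is connected, and a maximum cut \<open>(S, T)\<close> of the graph induced on \<open>R\<close>. Any orientation of the
  edges inside \<open>S\<close> and inside \<open>T\<close> is balanced by a unit flow through the cut edges (maximality of the cut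
  is the cut condition), so the edges inside \<open>R\<close> can add twice the indegree to the vertices of \<open>S\<close>
  and subtract it from the vertices of \<open>T\<close>; a greedy orientation makes the values inside \<open>S\<close> and
  inside \<open>T\<close> proper whatever offsets the vertices already have. If \<open>|R|\<close> is even, let \<open>F\<close> be an
  edge set of \<open>B\<close> with odd degrees on \<open>R\<close> and even degrees on \<open>U\<close>, and weight its edges by \<open>1\<close> towards
  \<open>S\<close> and \<open>-1\<close> towards \<open>T\<close>: the values are even on \<open>U\<close>, odd positive on \<open>S\<close>, odd negative on \<open>T\<close>.

  If \<open>R\<close> is independent, or \<open>d = 2\<close>, values modulo 3 suffice. If \<open>|R|\<close> is odd otherwise, one vertex \<open>r\<close>
  of \<open>R\<close> gets an even value, and only has to avoid the values of its neighbours in \<open>U\<close>; the freedom in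
  weighting the edges at \<open>r\<close> achieves this, provided \<open>r\<close> is a vertex with a neighbour in \<open>R\<close> that is as
  far as possible, within \<open>B\<close>, from a root in \<open>U\<close>.
\<close>

subsection \<open>Orientations, flows and joins\<close>

text \<open>Read \<open>I u w\<close> as: the edge between \<open>u\<close> and \<open>w\<close>
  points to \<open>u\<close>. Peel off a vertex \<open>v\<close> that maximizes \<open>p v\<close>
  plus twice its degree, and let all its edges point to it. A neighbour gains nothing from its edge
  to \<open>v\<close>, so it stays strictly below its own maximum and hence below \<open>v\<close>;
  induction settles the rest.\<close>

lemma proper_orientation:
  fixes p :: "'a \<Rightarrow> int"
  assumes "finite V" and "symp N" and "irreflp N"
  shows "\<exists>I. (\<forall>u\<in>V. \<forall>w\<in>V. N u w \<longrightarrow> I u w \<noteq> I w u \<and>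
           p u + 2 * int (card {x\<in>V. N u x \<and> I u x}) \<noteq> p w + 2 * int (card {x\<in>V. N w x \<and> I w x}))"
  using assms(1)
proof (induction "card V" arbitrary: V)
  case 0
  then show ?case by auto
next
  case (Suc n)
  define P where "P v = p v + 2 * int (card {x\<in>V. N v x})" for v
  have "V \<noteq> {}" using Suc by auto
  then obtain v where v: "v \<in> V" "\<And>w. w \<in> V \<Longrightarrow> P w \<le> P v"
    using obtains_MAX[OF \<open>finite V\<close>, of P] Max_ge[of "P ` V"] \<open>finite V\<close> by (metis finite_imageI imageI)
  define W where "W = V - {v}"
  have fin: "finite V" "finite W" using Suc by (auto simp: W_def)
  have "n = card W" using Suc v by (simp add: W_def)
  then obtain I where I: "\<And>u w. u \<in> W \<Longrightarrow> w \<in> W \<Longrightarrow> N u w \<Longrightarrow> I u w \<noteq> I w u \<and>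
           p u + 2 * int (card {x\<in>W. N u x \<and> I u x}) \<noteq> p w + 2 * int (card {x\<in>W. N w x \<and> I w x})"
    using Suc.hyps(1)[of W] fin by blast
  define J where "J a b \<longleftrightarrow> a = v \<or> (b \<noteq> v \<and> I a b)" for a b
  have qv: "{x\<in>V. N v x \<and> J v x} = {x\<in>V. N v x}" by (auto simp: J_def)
  have qw: "{x\<in>V. N w x \<and> J w x} = {x\<in>W. N w x \<and> I w x}" if "w \<in> W" for w
    using that by (auto simp: J_def W_def)
  have less: "p w + 2 * int (card {x\<in>V. N w x \<and> J w x}) < P v" if "w \<in> W" "N w v" for w
  proof -
    have "{x\<in>W. N w x \<and> I w x} \<subset> {x\<in>V. N w x}" using that v by (auto simp: W_def)
    then have "card {x\<in>W. N w x \<and> I w x} < card {x\<in>V. N w x}"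
      using fin by (simp add: psubset_card_mono)
    moreover have "P w \<le> P v" using v that by (simp add: W_def)
    ultimately show ?thesis using qw[OF that(1)] by (simp add: P_def)
  qed
  have "J u w \<noteq> J w u \<and>
           p u + 2 * int (card {x\<in>V. N u x \<and> J u x}) \<noteq> p w + 2 * int (card {x\<in>V. N w x \<and> J w x})"
    if uw: "u \<in> V" "w \<in> V" "N u w" for u w
  proof -
    have ne: "u \<noteq> w" using uw assms(3) by (auto dest: irreflpD)
    consider "u = v" | "w = v" | "u \<in> W" "w \<in> W" using uw by (auto simp: W_def)
    then show ?thesis
    proof cases
      case 1
      then have "w \<in> W" using uw ne by (auto simp: W_def)
      with less[of w] uw sympD[OF assms(2)] 1 ne show ?thesis unfolding 1 qv by (auto simp: P_def J_def)
    next
      case 2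
      then have "u \<in> W" using uw ne by (auto simp: W_def)
      with less[of u] uw 2 ne show ?thesis unfolding 2 qv by (auto simp: P_def J_def)
    next
      case 3
      then show ?thesis using I[OF 3 uw(3)] qw[of u] qw[of w] by (auto simp: J_def W_def)
    qed
  qed
  then show ?case by (intro exI[of _ J] ballI impI)
qed

section \<open>Integer flows, encoded as antisymmetric functions whose row sums are net
  outflows\<close>

definition skew :: "('a \<Rightarrow> 'a \<Rightarrow> int) \<Rightarrow> bool" where
  "skew y \<longleftrightarrow> (\<forall>u w. y w u = - y u w)"

lemma skewD: "skew y \<Longrightarrow> y w u = - y u w"
  unfolding skew_def by blast

lemma sum_skew_zero:
  fixes y :: "'a \<Rightarrow> 'a \<Rightarrow> int"
  assumes "finite X" "skew y"
  shows "(\<Sum>v\<in>X. \<Sum>w\<in>X. y v w) = 0"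
proof -
  have "(\<Sum>v\<in>X. \<Sum>w\<in>X. y v w) = (\<Sum>w\<in>X. \<Sum>v\<in>X. y v w)" by (rule sum.swap)
  also have "\<dots> = (\<Sum>w\<in>X. \<Sum>v\<in>X. - y w v)" by (intro sum.cong refl skewD[OF assms(2)])
  also have "\<dots> = - (\<Sum>w\<in>X. \<Sum>v\<in>X. y w v)" by (simp add: sum_negf)
  finally show ?thesis by linarith
qed

lemma sum_skew_boundary:
  assumes "finite V" "skew y" "X \<subseteq> V"
  shows "(\<Sum>u\<in>X. \<Sum>w\<in>V. y u w) = (\<Sum>u\<in>X. \<Sum>w\<in>V - X. y u w)"
proof -
  have "(\<Sum>u\<in>X. \<Sum>w\<in>V. y u w) = (\<Sum>u\<in>X. (\<Sum>w\<in>X. y u w) + (\<Sum>w\<in>V-X. y u w))"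
    using sum.subset_diff[OF assms(3,1)] by (intro sum.cong refl) (simp add: add.commute)
  also have "\<dots> = (\<Sum>u\<in>X. \<Sum>w\<in>V-X. y u w)"
    using sum_skew_zero[OF finite_subset[OF assms(3,1)] assms(2)] by (simp add: sum.distrib)
  finally show ?thesis .
qed

lemma sum_of_bool_pairs:
  assumes "finite X" "finite Y"
  shows "(\<Sum>u\<in>X. \<Sum>w\<in>Y. of_bool (C u w)) = int (card {(u, w). u \<in> X \<and> w \<in> Y \<and> C u w})"
proof -
  have "(\<Sum>u\<in>X. \<Sum>w\<in>Y. of_bool (C u w)) = (\<Sum>u\<in>X. int (card {w \<in> Y. C u w}))"
    using assms by (intro sum.cong refl) (simp add: sum.inter_filter[symmetric] of_bool_def)
  also have "\<dots> = int (card (SIGMA u:X. {w \<in> Y. C u w}))"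
    using assms by (simp add: card_SigmaI)
  also have "(SIGMA u:X. {w \<in> Y. C u w}) = {(u, w). u \<in> X \<and> w \<in> Y \<and> C u w}" by auto
  finally show ?thesis .
qed

lemma distinct_path:
  assumes "r\<^sup>*\<^sup>* a w"
  shows "\<exists>xs. distinct (a # xs) \<and> successively r (a # xs) \<and> last (a # xs) = w"
  using assms
proof (induction rule: converse_rtranclp_induct)
  case base
  show ?case by (intro exI[of _ "[]"]) auto
next
  case (step a c)
  then obtain xs where xs: "distinct (c # xs)" "successively r (c # xs)" "last (c # xs) = w" by blast
  show ?case
  proof (cases "a \<in> set (c # xs)")
    case True
    then obtain ys zs where s: "c # xs = ys @ a # zs" by (meson split_list)
    then have "distinct (a # zs)" "successively r (a # zs)" "last (a # zs) = w"
      using xs by (metis distinct_append, metis successively_append_iff list.discI, metis last_appendR list.discI)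
    then show ?thesis by blast
  next
    case False
    then show ?thesis using xs step by (intro exI[of _ "c # xs"]) auto
  qed
qed

text \<open>One unit is pushed along a residual path, arc by arc; gains and losses at inner vertices
  cancel.\<close>

lemma augment:
  fixes y :: "'a \<Rightarrow> 'a \<Rightarrow> int"
  assumes "finite V"
  assumes "distinct (a # xs)"
    and "successively (\<lambda>a c. a \<in> V \<and> c \<in> V \<and> C a c \<and> y a c < 1) (a # xs)"
    and "skew y" "\<And>u w. \<not> C u w \<Longrightarrow> y u w = 0" "\<And>u w. \<bar>y u w\<bar> \<le> 1"
    and "\<And>u w. C u w \<Longrightarrow> C w u"
  shows "\<exists>y'. skew y' \<and> (\<forall>u w. \<not> C u w \<longrightarrow> y' u w = 0) \<and> (\<forall>u w. \<bar>y' u w\<bar> \<le> 1) \<and>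
    (\<forall>v\<in>V. (\<Sum>w\<in>V. y' v w) = (\<Sum>w\<in>V. y v w) + of_bool (v = a) - of_bool (v = last (a # xs)))"
  using assms(2-6)
proof (induction xs arbitrary: a y)
  case Nil
  then show ?case by (intro exI[of _ y]) auto
next
  case (Cons c xs)
  have ac: "a \<in> V" "c \<in> V" "C a c" "y a c < 1" "a \<noteq> c" using Cons.prems(1,2) by auto
  define z where "z u w = y u w + of_bool (u = a \<and> w = c) - of_bool (u = c \<and> w = a)" for u w
  have "skew z" unfolding skew_def
  proof (intro allI)
    show "z w u = - z u w" for u w
      by (simp add: z_def conj_commute skewD[OF Cons.prems(3), of w u])
  qed
  moreover have "\<not> C u w \<Longrightarrow> z u w = 0" for u w
    using Cons.prems(4)[of u w] ac assms(7) by (auto simp: z_def)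
  moreover have "\<bar>z u w\<bar> \<le> 1" for u w
    using Cons.prems(5)[of u w] ac skewD[OF Cons.prems(3), of c a]
    by (cases "u = a \<and> w = c"; cases "u = c \<and> w = a") (auto simp: z_def)
  moreover have "distinct (c # xs)" using Cons.prems(1) by auto
  \<comment> \<open>The rest of the path avoids \<open>a\<close>, so pushing along the first arc
    leaves its residual capacities unchanged.\<close>
  moreover have "successively (\<lambda>a c. a \<in> V \<and> c \<in> V \<and> C a c \<and> z a c < 1) (c # xs)"
  proof -
    have 1: "successively (\<lambda>a c. a \<in> V \<and> c \<in> V \<and> C a c \<and> y a c < 1) (c # xs)"
      using Cons.prems(2) by auto
    have 2: "a \<notin> set (c # xs)" using Cons.prems(1) by auto
    show ?thesis
      by (rule successively_mono[OF 1]) (use 2 in \<open>auto simp: z_def\<close>)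
  qed
  ultimately obtain y' where y': "skew y'" "\<forall>u w. \<not> C u w \<longrightarrow> y' u w = 0"
      "\<forall>u w. \<bar>y' u w\<bar> \<le> 1"
      "\<forall>v\<in>V. (\<Sum>w\<in>V. y' v w) = (\<Sum>w\<in>V. z v w) + of_bool (v = c) - of_bool (v = last (c # xs))"
    using Cons.IH[of c z] by blast
  have "(\<Sum>w\<in>V. z v w) = (\<Sum>w\<in>V. y v w) + of_bool (v = a) - of_bool (v = c)" if "v \<in> V" for v
  proof -
    have "(\<Sum>w\<in>V. z v w) = (\<Sum>w\<in>V. y v w) + (\<Sum>w\<in>V. of_bool (v = a \<and> w = c)) - (\<Sum>w\<in>V. of_bool (v = c \<and> w = a))"
      by (simp add: z_def sum.distrib sum_subtractf)
    moreover have "(\<Sum>w\<in>V. of_bool (v = a \<and> w = c)) = (of_bool (v = a) :: int)"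
      using ac \<open>finite V\<close> by (cases "v = a") (auto simp: of_bool_def)
    moreover have "(\<Sum>w\<in>V. of_bool (v = c \<and> w = a)) = (of_bool (v = c) :: int)"
      using ac \<open>finite V\<close> by (cases "v = c") (auto simp: of_bool_def)
    ultimately show ?thesis by simp
  qed
  then show ?case using y' by (intro exI[of _ y']) auto
qed

text \<open>A max-flow min-cut argument with unit capacities. Take a flow with least total deviation
  from \<open>b\<close>. From a vertex with too little outflow, either a residual path leads to a
  vertex with too much, and augmenting lowers the deviation, or the set reached by residual arcs
  violates the cut condition.\<close>

lemma unit_flow:
  fixes b :: "'a \<Rightarrow> int"
  assumes fin: "finite V" and C: "\<And>u w. C u w \<Longrightarrow> C w u"
    and cut: "\<And>X. X \<subseteq> V \<Longrightarrow> sum b X \<le> int (card {(u, w). u \<in> X \<and> w \<in> V - X \<and> C u w})"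
    and b0: "sum b V = 0"
  shows "\<exists>y. skew y \<and> (\<forall>u w. \<not> C u w \<longrightarrow> y u w = 0) \<and> (\<forall>u w. \<bar>y u w\<bar> \<le> 1) \<and>
    (\<forall>v\<in>V. (\<Sum>w\<in>V. y v w) = b v)"
proof -
  define ok where "ok y \<longleftrightarrow> skew y \<and> (\<forall>u w. \<not> C u w \<longrightarrow> y u w = 0) \<and>
      (\<forall>u w. \<bar>y u w\<bar> \<le> (1::int))" for y
  define dv where "dv y v = (\<Sum>w\<in>V. y v w)" for y :: "'a \<Rightarrow> 'a \<Rightarrow> int" and v
  define m where "m y = nat (\<Sum>v\<in>V. \<bar>b v - dv y v\<bar>)" for y
  have "ok (\<lambda>_ _. 0)" by (simp add: ok_def skew_def)
  then obtain y where y: "ok y" and min: "\<And>z. ok z \<Longrightarrow> m y \<le> m z"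
    using ex_has_least_nat[of ok _ m] by blast
  have "\<forall>v\<in>V. dv y v = b v"
  proof (rule ccontr)
    assume "\<not> ?thesis"
    have ant: "skew y" using y unfolding ok_def by blast
    have "(\<Sum>v\<in>V. b v - dv y v) = 0"
      using b0 sum_skew_zero[OF fin ant] by (simp add: sum_subtractf dv_def)
    have "\<exists>v\<in>V. dv y v < b v"
    proof (rule ccontr)
      assume "\<not> (\<exists>v\<in>V. dv y v < b v)"
      then have "\<And>v. v \<in> V \<Longrightarrow> dv y v - b v \<ge> 0" by force
      moreover have "(\<Sum>v\<in>V. dv y v - b v) = 0"
        using \<open>(\<Sum>v\<in>V. b v - dv y v) = 0\<close> by (simp add: sum_subtractf)
      ultimately have "\<forall>v\<in>V. dv y v - b v = 0" using sum_nonneg_eq_0_iff[OF fin] by (metis (no_types, lifting))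
      with \<open>\<not> (\<forall>v\<in>V. dv y v = b v)\<close> show False by auto
    qed
    then obtain v where v: "v \<in> V" "dv y v < b v" by blast
    define res where "res a c \<longleftrightarrow> a \<in> V \<and> c \<in> V \<and> C a c \<and> y a c < 1" for a c
    define X where "X = {w\<in>V. res\<^sup>*\<^sup>* v w}"
    have XV: "X \<subseteq> V" "finite X" using fin by (auto simp: X_def)
    have vX: "v \<in> X" using v by (simp add: X_def)
    show False
    proof (cases "\<exists>w\<in>X. b w < dv y w")
      case True
      then obtain w where w: "w \<in> V" "res\<^sup>*\<^sup>* v w" "b w < dv y w" by (auto simp: X_def)
      obtain xs where xs: "distinct (v # xs)" "successively res (v # xs)" "last (v # xs) = w"
        using distinct_path[OF w(2)] by blast
      have "\<exists>z. ok z \<and> (\<forall>x\<in>V. dv z x = dv y x + of_bool (x = v) - of_bool (x = w))"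
        using augment[of V v xs C y] fin xs y C unfolding ok_def dv_def res_def[abs_def] by auto
      then obtain z where z: "ok z" "\<And>x. x\<in>V \<Longrightarrow> dv z x = dv y x + of_bool (x = v) - of_bool (x = w)" by blast
      have "(\<Sum>x\<in>V. \<bar>b x - dv z x\<bar>) < (\<Sum>x\<in>V. \<bar>b x - dv y x\<bar>)"
      proof (rule sum_strict_mono_ex1[OF fin])
        show "\<forall>x\<in>V. \<bar>b x - dv z x\<bar> \<le> \<bar>b x - dv y x\<bar>" using z v w by auto
        show "\<exists>x\<in>V. \<bar>b x - dv z x\<bar> < \<bar>b x - dv y x\<bar>" using z v w by (intro bexI[of _ v]) auto
      qed
      moreover have "(\<Sum>x\<in>V. \<bar>b x - dv z x\<bar>) \<ge> 0" by (simp add: sum_nonneg)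
      ultimately have "m z < m y" unfolding m_def by linarith
      with min[OF z(1)] show False by simp
    next
      case False
      then have "sum (dv y) X < sum b X"
        using vX v XV by (intro sum_strict_mono_ex1) (auto simp: not_less)
      moreover have "sum (dv y) X = int (card {(u, w). u \<in> X \<and> w \<in> V - X \<and> C u w})"
      proof -
        \<comment> \<open>An arc leaving \<open>X\<close> has no residual capacity and carries a
          full unit. So the outflow of \<open>X\<close> is the size of its cut, although it is
          smaller than \<open>sum b X\<close>.\<close>
        have one: "y u w = of_bool (C u w)" if "u \<in> X" "w \<in> V - X" for u w
        proof (cases "C u w")
          case True
          have "\<not> res u w" using that unfolding X_def by (auto intro: rtranclp.rtrancl_into_rtrancl)
          then have "\<not> y u w < 1" using that True XV by (auto simp: res_def)
          moreover have "\<bar>y u w\<bar> \<le> 1" using y unfolding ok_def by blast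
          ultimately show ?thesis using True by auto
        next
          case False
          then show ?thesis using y unfolding ok_def by auto
        qed
        have "sum (dv y) X = (\<Sum>u\<in>X. \<Sum>w\<in>V-X. y u w)"
          unfolding dv_def by (rule sum_skew_boundary[OF fin ant XV(1)])
        also have "\<dots> = (\<Sum>u\<in>X. \<Sum>w\<in>V-X. of_bool (C u w))"
          using one by (intro sum.cong refl) auto
        also have "\<dots> = int (card {(u, w). u \<in> X \<and> w \<in> V - X \<and> C u w})"
          using XV fin by (intro sum_of_bool_pairs) auto
        finally show ?thesis .
      qed
      ultimately show False using cut[OF XV(1)] by linarith
    qed
  qed
  then show ?thesis using y unfolding ok_def dv_def by blast
qed

lemma path_flow:
  assumes "finite V" "\<And>u w. B u w \<Longrightarrow> B w u" "\<And>u w. B u w \<Longrightarrow> u \<in> V" "\<And>u. \<not> B u u"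
    and "B\<^sup>*\<^sup>* a b"
  shows "\<exists>y. skew y \<and> (\<forall>u w. \<not> B u w \<longrightarrow> y u w = 0) \<and>
           (\<forall>v\<in>V. (\<Sum>w\<in>V. y v w) = of_bool (v = a) - of_bool (v = b))"
  using assms(5)
proof (induction rule: rtranclp_induct)
  case base
  show ?case by (intro exI[of _ "\<lambda>_ _. 0"]) (simp add: skew_def)
next
  case (step c b)
  then obtain y where y: "skew y" "\<And>u w. \<not> B u w \<Longrightarrow> y u w = 0"
    "\<And>v. v \<in> V \<Longrightarrow> (\<Sum>w\<in>V. y v w) = of_bool (v = a) - of_bool (v = c)" by blast
  have cb: "c \<in> V" "b \<in> V" "c \<noteq> b" "B c b" "B b c" using step assms(2-4) by blast+
  define z where "z u w = y u w + of_bool (u = c \<and> w = b) - of_bool (u = b \<and> w = c)" for u w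
  have "skew z" unfolding skew_def
  proof (intro allI)
    show "z w u = - z u w" for u w
      by (simp add: z_def conj_commute skewD[OF y(1), of w u])
  qed
  moreover have "z u w = 0" if "\<not> B u w" for u w
    using that cb y(2)[OF that] by (auto simp: z_def)
  moreover have "(\<Sum>w\<in>V. z v w) = of_bool (v = a) - of_bool (v = b)" if "v \<in> V" for v
  proof -
    have "(\<Sum>w\<in>V. z v w) = (\<Sum>w\<in>V. y v w) + (\<Sum>w\<in>V. of_bool (v = c \<and> w = b)) - (\<Sum>w\<in>V. of_bool (v = b \<and> w = c))"
      by (simp add: z_def sum.distrib sum_subtractf)
    moreover have "(\<Sum>w\<in>V. of_bool (v = c \<and> w = b)) = (of_bool (v = c) :: int)"
      using cb \<open>finite V\<close> by (cases "v = c") (auto simp: of_bool_def)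
    moreover have "(\<Sum>w\<in>V. of_bool (v = b \<and> w = c)) = (of_bool (v = b) :: int)"
      using cb \<open>finite V\<close> by (cases "v = b") (auto simp: of_bool_def)
    ultimately show ?thesis using y(3)[OF that] by simp
  qed
  ultimately show ?case by blast
qed

text \<open>Superpose, for every \<open>x\<close>, \<open>c x\<close> times a unit flow from
  \<open>x\<close> to the root; the root comes out right because \<open>c\<close> sums to zero. The
  flow may exceed 1, as it is later reduced modulo 2 or 3.\<close>

lemma connected_flow:
  fixes c :: "'a \<Rightarrow> int"
  assumes "finite V" "\<And>u w. B u w \<Longrightarrow> B w u" "\<And>u w. B u w \<Longrightarrow> u \<in> V" "\<And>u. \<not> B u u"
    and root: "\<rho> \<in> V" "\<And>v. v \<in> V \<Longrightarrow> B\<^sup>*\<^sup>* v \<rho>" and "sum c V = 0"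
  shows "\<exists>y. skew y \<and> (\<forall>u w. \<not> B u w \<longrightarrow> y u w = 0) \<and> (\<forall>v\<in>V. (\<Sum>w\<in>V. y v w) = c v)"
proof -
  have "\<forall>x\<in>V. \<exists>y. skew y \<and> (\<forall>u w. \<not> B u w \<longrightarrow> y u w = 0) \<and>
           (\<forall>v\<in>V. (\<Sum>w\<in>V. y v w) = of_bool (v = x) - of_bool (v = \<rho>))"
    using path_flow[of V B] assms(1-4) root(2) by blast
  then obtain y where y: "\<And>x. x \<in> V \<Longrightarrow> skew (y x)" "\<And>x u w. x \<in> V \<Longrightarrow> \<not> B u w \<Longrightarrow> y x u w = 0"
      "\<And>x v. x \<in> V \<Longrightarrow> v \<in> V \<Longrightarrow> (\<Sum>w\<in>V. y x v w) = of_bool (v = x) - of_bool (v = \<rho>)"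
    by (subst (asm) bchoice_iff) blast
  define z where "z u w = (\<Sum>x\<in>V. c x * y x u w)" for u w
  have "skew z" unfolding skew_def
  proof (intro allI)
    show "z w u = - z u w" for u w
      unfolding z_def sum_negf[symmetric] by (intro sum.cong refl) (simp add: skewD[OF y(1), of _ w u])
  qed
  moreover have "z u w = 0" if "\<not> B u w" for u w
    using y(2)[OF _ that] by (simp add: z_def)
  moreover have "(\<Sum>w\<in>V. z v w) = c v" if "v \<in> V" for v
  proof -
    have "(\<Sum>w\<in>V. z v w) = (\<Sum>x\<in>V. c x * (\<Sum>w\<in>V. y x v w))"
      unfolding z_def sum_distrib_left by (rule sum.swap)
    also have "\<dots> = (\<Sum>x\<in>V. c x * of_bool (v = x)) - (\<Sum>x\<in>V. c x) * of_bool (v = \<rho>)"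
      using y(3) that by (simp add: right_diff_distrib sum_subtractf sum_distrib_right)
    also have "\<dots> = c v" using assms(1,7) that by (simp add: of_bool_def if_distrib cong: if_cong)
    finally show ?thesis .
  qed
  ultimately show ?thesis by blast
qed

section \<open>Edge sets with prescribed degree parities\<close>

lemma even_sum_card_odd:
  fixes f :: "'a \<Rightarrow> int"
  assumes "finite V"
  shows "even (\<Sum>w\<in>V. f w) \<longleftrightarrow> even (card {w\<in>V. odd (f w)})"
  using assms
proof (induction V rule: finite_induct)
  case (insert x F)
  have "{w\<in>insert x F. odd (f w)} = (if odd (f x) then insert x {w\<in>F. odd (f w)} else {w\<in>F. odd (f w)})"
    by auto
  then show ?case using insert by auto
qed simp

text \<open>The odd entries of an integer flow form an edge set whose degrees have the parities of
  the net outflows.\<close>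

lemma tjoin:
  assumes "finite V" "\<And>u w. B u w \<Longrightarrow> B w u" "\<And>u w. B u w \<Longrightarrow> u \<in> V" "\<And>u. \<not> B u u"
    and root: "\<rho> \<in> V" "\<And>v. v \<in> V \<Longrightarrow> B\<^sup>*\<^sup>* v \<rho>" and T: "T \<subseteq> V" "even (card T)"
  shows "\<exists>F. (\<forall>u w. F u w \<longrightarrow> B u w) \<and> (\<forall>u w. F u w \<longrightarrow> F w u) \<and>
           (\<forall>v\<in>V. odd (card {w\<in>V. F v w}) \<longleftrightarrow> v \<in> T)"
proof -
  \<comment> \<open>Subtracting \<open>card T\<close> at the root makes the total zero and, being
    even, changes no parity.\<close>
  define c where "c v = (of_bool (v \<in> T) - of_bool (v = \<rho>) * int (card T))" for v
  have "sum c V = (\<Sum>v\<in>V. of_bool (v \<in> T)) - (\<Sum>v\<in>V. of_bool (v = \<rho>) * int (card T))"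
    by (simp add: c_def sum_subtractf)
  also have "(\<Sum>v\<in>V. of_bool (v \<in> T)) = int (card T)"
    using assms(1) T by (simp add: of_bool_def sum.inter_restrict[symmetric] Int_absorb1)
  also have "(\<Sum>v\<in>V. of_bool (v = \<rho>) * int (card T)) = int (card T)"
    using assms(1) root by (simp add: of_bool_def flip: sum_distrib_right)
  finally have "sum c V = 0" by simp
  then obtain y where y: "skew y" "\<And>u w. \<not> B u w \<Longrightarrow> y u w = 0" "\<And>v. v\<in>V \<Longrightarrow> (\<Sum>w\<in>V. y v w) = c v"
    using connected_flow[of V B \<rho> c] assms by blast
  have "odd (card {w\<in>V. odd (y v w)}) \<longleftrightarrow> v \<in> T" if "v \<in> V" for v
    using even_sum_card_odd[OF assms(1), of "y v"] y(3)[OF that] T by (cases "v \<in> T") (simp_all add: c_def)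
  moreover have "odd (y w u)" if "odd (y u w)" for u w
    using that skewD[OF y(1), of w u] by simp
  moreover have "B u w" if "odd (y u w)" for u w
    using that y(2)[of u w] by (cases "B u w") auto
  ultimately show ?thesis
    by (intro exI[of _ "\<lambda>u w. odd (y u w)"]) blast
qed

text \<open>One unit of flow along a path is enough here, so the lemma also serves graphs that
  deletions have disconnected.\<close>

lemma path_tjoin:
  assumes "finite V" "\<And>u w. B u w \<Longrightarrow> B w u" "\<And>u w. B u w \<Longrightarrow> u \<in> V" "\<And>u. \<not> B u u"
    and "B\<^sup>*\<^sup>* a b" "a \<noteq> b"
  shows "\<exists>F. (\<forall>u w. F u w \<longrightarrow> B u w) \<and> (\<forall>u w. F u w \<longrightarrow> F w u) \<and>
           (\<forall>v\<in>V. odd (card {w\<in>V. F v w}) \<longleftrightarrow> v = a \<or> v = b)"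
proof -
  obtain y where y: "skew y" "\<And>u w. \<not> B u w \<Longrightarrow> y u w = 0"
     "\<And>v. v\<in>V \<Longrightarrow> (\<Sum>w\<in>V. y v w) = of_bool (v = a) - of_bool (v = b)"
    using path_flow[of V B a b] assms by blast
  have "odd (card {w\<in>V. odd (y v w)}) \<longleftrightarrow> v = a \<or> v = b" if "v \<in> V" for v
    using even_sum_card_odd[OF assms(1), of "y v"] y(3)[OF that] assms(6) by auto
  moreover have "odd (y w u)" if "odd (y u w)" for u w
    using that skewD[OF y(1), of w u] by simp
  moreover have "B u w" if "odd (y u w)" for u w
    using that y(2)[of u w] by (cases "B u w") auto
  ultimately show ?thesis
    by (intro exI[of _ "\<lambda>u w. odd (y u w)"]) blast
qed

lemma odd_card_xor:
  assumes "finite V"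
  shows "odd (card {w\<in>V. F w \<noteq> G w}) \<longleftrightarrow> odd (card {w\<in>V. F w}) \<noteq> odd (card {w\<in>V. G w})"
  using assms
proof (induction V rule: finite_induct)
  case (insert x V)
  have e: "{w\<in>insert x V. H w} = (if H x then insert x {w\<in>V. H w} else {w\<in>V. H w})" for H by auto
  show ?case unfolding e[of F] e[of G] e[of "\<lambda>w. F w \<noteq> G w"] using insert by auto
qed simp

section \<open>Maximum cuts and signings\<close>

lemma max_cut:
  fixes E :: "'a \<Rightarrow> 'a \<Rightarrow> bool"
  assumes "finite V" "\<And>u w. E u w \<Longrightarrow> E w u"
  shows "\<exists>S :: 'a \<Rightarrow> bool. \<forall>X\<subseteq>V. card {(u, w). u \<in> X \<and> w \<in> V - X \<and> E u w \<and> (S u = S w)}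
               \<le> card {(u, w). u \<in> X \<and> w \<in> V - X \<and> E u w \<and> (S u \<noteq> S w)}"
proof -
  define c where "c S = card {(u, w). u \<in> V \<and> w \<in> V \<and> E u w \<and> (S u \<noteq> S w)}" for S :: "'a \<Rightarrow> bool"
  have bound: "c S \<le> card (V \<times> V)" for S unfolding c_def using assms(1) by (intro card_mono) auto
  then obtain S where S: "\<And>S'. c S' \<le> c S"
    using ex_has_greatest_nat[of "\<lambda>_. True" _ c "Suc (card (V \<times> V))"] by (auto simp: less_Suc_eq_le)
  show ?thesis
  proof (intro exI[of _ S] allI impI)
    fix X assume X: "X \<subseteq> V"
    \<comment> \<open>Moving all of \<open>X\<close> to the other side exchanges cut and uncut pairs
      on the boundary of \<open>X\<close> and keeps the cut pairs \<open>K\<close> elsewhere.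
      Ordered pairs count every edge twice, hence the swapped copies of \<open>P b\<close>
      below.\<close>
    define S' where "S' u \<longleftrightarrow> (S u \<noteq> (u \<in> X))" for u
    define K where "K = {(u, w). u \<in> V \<and> w \<in> V \<and> (u \<in> X \<longleftrightarrow> w \<in> X) \<and> E u w \<and> S u \<noteq> S w}"
    define P where "P b = {(u, w). u \<in> X \<and> w \<in> V - X \<and> E u w \<and> ((S u = S w) = b)}" for b
    have fin: "finite X" using X assms(1) finite_subset by blast
    have finP: "finite (P b)" for b
      by (rule finite_subset[of _ "X \<times> V"]) (use fin assms(1) in \<open>auto simp: P_def\<close>)
    have finK: "finite K"
      by (rule finite_subset[of _ "V \<times> V"]) (use assms(1) in \<open>auto simp: K_def\<close>)
    have cP: "card (prod.swap ` P b) = card (P b)" for b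
      by (intro card_image) (auto simp: inj_on_def)
    have "{(u, w). u \<in> V \<and> w \<in> V \<and> E u w \<and> (S u \<noteq> S w)} = K \<union> (P False \<union> prod.swap ` P False)"
      using X assms(2) by (auto simp: K_def P_def image_iff)
    moreover have "{(u, w). u \<in> V \<and> w \<in> V \<and> E u w \<and> (S' u \<noteq> S' w)} = K \<union> (P True \<union> prod.swap ` P True)"
      using X assms(2) by (auto simp: K_def P_def image_iff S'_def)
    moreover have "card (K \<union> (P b \<union> prod.swap ` P b)) = card K + 2 * card (P b)" for b
    proof -
      have "K \<inter> (P b \<union> prod.swap ` P b) = {}" "P b \<inter> prod.swap ` P b = {}"
        by (auto simp: K_def P_def)
      then show ?thesis using finP finK by (simp add: card_Un_disjoint cP)
    qed
    ultimately have "card (P True) \<le> card (P False)" using S[of S'] unfolding c_def by simp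
    then show "card {(u, w). u \<in> X \<and> w \<in> V - X \<and> E u w \<and> (S u = S w)}
               \<le> card {(u, w). u \<in> X \<and> w \<in> V - X \<and> E u w \<and> (S u \<noteq> S w)}"
      by (simp add: P_def)
  qed
qed

text \<open>The offsets \<open>p\<close> stand for the edges that leave \<open>R\<close>. The signs \<open>\<sigma>\<close>, the sides of the cut, must not
  depend on them, because the weights of those edges are chosen according to \<open>\<sigma>\<close>.\<close>

definition signing :: "'a set \<Rightarrow> ('a \<Rightarrow> 'a \<Rightarrow> bool) \<Rightarrow> ('a \<Rightarrow> int) \<Rightarrow> bool" where
  "signing R E \<sigma> \<longleftrightarrow> (\<forall>v. \<sigma> v = 1 \<or> \<sigma> v = -1) \<and>
    (\<forall>p :: 'a \<Rightarrow> int. \<exists>x. (\<forall>u w. x w u = x u w) \<and> (\<forall>u w. x u w \<noteq> 0 \<longrightarrow> u \<in> R \<and> w \<in> R \<and> E u w) \<and>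
      (\<forall>u w. \<bar>x u w\<bar> \<le> 1) \<and> (\<forall>v\<in>R. \<exists>k. \<sigma> v * (\<Sum>w\<in>R. x v w) = 2 * int k) \<and>
      (\<forall>u\<in>R. \<forall>w\<in>R. E u w \<longrightarrow> \<sigma> u = \<sigma> w \<longrightarrow>
         p u + \<sigma> u * (\<Sum>t\<in>R. x u t) \<noteq> p w + \<sigma> w * (\<Sum>t\<in>R. x w t)))"

lemma signing_sign: "signing R E \<sigma> \<Longrightarrow> \<sigma> v = 1 \<or> \<sigma> v = -1"
  unfolding signing_def by blast

text \<open>The signs are the sides of a maximum cut. Orient the uncut edges \<open>N\<close>
  properly for \<open>p\<close>, and let a unit flow \<open>y\<close> on the cut edges
  \<open>C\<close> have the excess of indegree over outdegree as its net outflow. Weights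
  \<open>\<sigma> u\<close> on \<open>N\<close> and \<open>\<sigma> u * y u w\<close> on
  \<open>C\<close> then sum, up to the sign, to degree plus indegree minus outdegree in
  \<open>N\<close>, that is, to twice the indegree.\<close>

lemma ex_signing:
  fixes E :: "'a \<Rightarrow> 'a \<Rightarrow> bool"
  assumes fin: "finite R" and "symp E" and "irreflp E"
  shows "\<exists>\<sigma>. signing R E \<sigma>"
proof -
  have sym: "\<And>u w. E u w \<Longrightarrow> E w u" and irr: "\<And>u. \<not> E u u"
    using assms(2,3) by (auto dest: sympD irreflpD)
  obtain S :: "'a \<Rightarrow> bool" where S: "\<And>X. X \<subseteq> R \<Longrightarrow>
      card {(u, w). u \<in> X \<and> w \<in> R - X \<and> E u w \<and> (S u = S w)}
        \<le> card {(u, w). u \<in> X \<and> w \<in> R - X \<and> E u w \<and> (S u \<noteq> S w)}"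
    using max_cut[OF fin, of E] sym by blast
  define \<sigma> where "\<sigma> v = (if S v then 1 else -1 :: int)" for v
  define N where "N u w \<longleftrightarrow> u \<in> R \<and> w \<in> R \<and> E u w \<and> S u = S w" for u w
  define C where "C u w \<longleftrightarrow> u \<in> R \<and> w \<in> R \<and> E u w \<and> S u \<noteq> S w" for u w
  have Nsym: "N u w \<Longrightarrow> N w u" and Csym: "C u w \<Longrightarrow> C w u" and Nirr: "\<not> N u u" for u w
    using sym[of u w] irr[of u] by (auto simp: N_def C_def)
  have NN: "symp N" "irreflp N" using Nsym Nirr by (auto intro: sympI irreflpI)
  have \<sigma>\<sigma>: "\<sigma> v * \<sigma> v = 1" for v by (simp add: \<sigma>_def)
  have main: "\<exists>x. (\<forall>u w. x w u = x u w) \<and> (\<forall>u w. x u w \<noteq> 0 \<longrightarrow> u \<in> R \<and> w \<in> R \<and> E u w) \<and>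
      (\<forall>u w. \<bar>x u w\<bar> \<le> 1) \<and> (\<forall>v\<in>R. \<exists>k. \<sigma> v * (\<Sum>w\<in>R. x v w) = 2 * int k) \<and>
      (\<forall>u\<in>R. \<forall>w\<in>R. E u w \<longrightarrow> \<sigma> u = \<sigma> w \<longrightarrow>
         p u + \<sigma> u * (\<Sum>t\<in>R. x u t) \<noteq> p w + \<sigma> w * (\<Sum>t\<in>R. x w t))" for p :: "'a \<Rightarrow> int"
  proof -
    obtain I where I: "\<forall>u\<in>R. \<forall>w\<in>R. N u w \<longrightarrow> I u w \<noteq> I w u \<and>
           p u + 2 * int (card {x\<in>R. N u x \<and> I u x}) \<noteq> p w + 2 * int (card {x\<in>R. N w x \<and> I w x})"
      using proper_orientation[OF fin NN, of p] by (elim exE)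
    define \<beta> where "\<beta> u w = (if N u w then if I u w then 1 else -1 else 0 :: int)" for u w
    have \<beta>: "skew \<beta>" unfolding skew_def
    proof (intro allI)
      show "\<beta> w u = - \<beta> u w" for u w
      proof (cases "N u w")
        case True
        then have "u \<in> R" "w \<in> R" by (auto simp: N_def)
        then show ?thesis using bspec[OF bspec[OF I], of u w] True Nsym[of u w] by (auto simp: \<beta>_def)
      next
        case False
        then show ?thesis using Nsym[of w u] by (auto simp: \<beta>_def)
      qed
    qed
    define b where "b v = (\<Sum>w\<in>R. \<beta> v w)" for v
    have "sum b X \<le> int (card {(u, w). u \<in> X \<and> w \<in> R - X \<and> C u w})" if X: "X \<subseteq> R" for X
    proof -
      have finX: "finite X" using X fin finite_subset by blast
      have "sum b X = (\<Sum>u\<in>X. \<Sum>w\<in>R-X. \<beta> u w)"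
        unfolding b_def using sum_skew_boundary[OF fin \<beta> X] .
      also have "\<dots> \<le> (\<Sum>u\<in>X. \<Sum>w\<in>R-X. of_bool (N u w))"
        by (intro sum_mono) (simp add: \<beta>_def)
      also have "\<dots> = int (card {(u, w). u \<in> X \<and> w \<in> R - X \<and> N u w})"
        using finX fin by (intro sum_of_bool_pairs) auto
      also have "{(u, w). u \<in> X \<and> w \<in> R - X \<and> N u w} = {(u, w). u \<in> X \<and> w \<in> R - X \<and> E u w \<and> (S u = S w)}"
        using X by (auto simp: N_def)
      \<comment> \<open>Maximality of the cut turns the bound by uncut edges into the cut condition
        for \<open>C\<close>.\<close>
      also have "int (card \<dots>) \<le> int (card {(u, w). u \<in> X \<and> w \<in> R - X \<and> E u w \<and> (S u \<noteq> S w)})"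
        using S[OF X] by simp
      also have "{(u, w). u \<in> X \<and> w \<in> R - X \<and> E u w \<and> (S u \<noteq> S w)} = {(u, w). u \<in> X \<and> w \<in> R - X \<and> C u w}"
        using X by (auto simp: C_def)
      finally show ?thesis .
    qed
    moreover have "sum b R = 0" unfolding b_def using sum_skew_zero[OF fin \<beta>] .
    ultimately obtain y where y: "skew y" "\<And>u w. \<not> C u w \<Longrightarrow> y u w = 0" "\<And>u w. \<bar>y u w\<bar> \<le> 1"
        "\<And>v. v \<in> R \<Longrightarrow> (\<Sum>w\<in>R. y v w) = b v"
      using unit_flow[of R C b] fin Csym by blast
    define x where "x u w = (if N u w then \<sigma> u else \<sigma> u * y u w)" for u w
    have NC: "N u w \<Longrightarrow> \<not> C u w" for u w by (auto simp: N_def C_def)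
    have q: "\<sigma> v * (\<Sum>w\<in>R. x v w) = 2 * int (card {w\<in>R. N v w \<and> I v w})" if "v \<in> R" for v
    proof -
      have "\<sigma> v * (\<Sum>w\<in>R. x v w) = (\<Sum>w\<in>R. of_bool (N v w) + y v w)"
        unfolding sum_distrib_left x_def
        using y(2) NC by (intro sum.cong refl) (auto simp: \<sigma>\<sigma> mult.assoc[symmetric])
      also have "\<dots> = (\<Sum>w\<in>R. of_bool (N v w) + \<beta> v w)"
        using y(4)[OF that] by (simp add: sum.distrib b_def)
      also have "\<dots> = (\<Sum>w\<in>R. if N v w \<and> I v w then 2 else 0)"
        by (intro sum.cong refl) (simp add: \<beta>_def)
      also have "\<dots> = 2 * int (card {w\<in>R. N v w \<and> I v w})"
        using fin by (simp add: sum.inter_filter[symmetric])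
      finally show ?thesis .
    qed
    \<comment> \<open>The ends of a cut edge have opposite signs, which makes the weight symmetric
      although \<open>y\<close> is skew.\<close>
    have "x w u = x u w" for u w
    proof (cases "C u w")
      case True
      then show ?thesis using Csym[OF True] NC[of u w] NC[of w u] skewD[OF y(1), of w u]
        by (auto simp: x_def \<sigma>_def C_def)
    next
      case False
      then have "\<not> C w u" using Csym by blast
      moreover have "N w u = N u w" using Nsym by blast
      moreover have "\<sigma> w = \<sigma> u" if "N u w" using that by (simp add: N_def \<sigma>_def)
      ultimately show ?thesis using False y(2)[of u w] y(2)[of w u] by (simp add: x_def)
    qed
    moreover have "u \<in> R \<and> w \<in> R \<and> E u w" if "x u w \<noteq> 0" for u w
    proof (cases "N u w")
      case True then show ?thesis by (simp add: N_def)
    next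
      case False
      then have "y u w \<noteq> 0" using that by (simp add: x_def)
      then have "C u w" using y(2) by blast
      then show ?thesis by (simp add: C_def)
    qed
    moreover have "\<bar>x u w\<bar> \<le> 1" for u w
      using y(3)[of u w] by (simp add: x_def \<sigma>_def abs_mult)
    moreover have "p u + \<sigma> u * (\<Sum>t\<in>R. x u t) \<noteq> p w + \<sigma> w * (\<Sum>t\<in>R. x w t)"
      if "u \<in> R" "w \<in> R" "E u w" "\<sigma> u = \<sigma> w" for u w
    proof -
      have "N u w" using that by (auto simp: N_def \<sigma>_def split: if_splits)
      then show ?thesis
        using bspec[OF bspec[OF I], of u w] that(1,2) q[OF that(1)] q[OF that(2)] by simp
    qed
    moreover have "\<exists>k. \<sigma> v * (\<Sum>w\<in>R. x v w) = 2 * int k" if "v \<in> R" for v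
      using q[OF that] by blast
    ultimately show ?thesis by (intro exI[of _ x] conjI allI ballI impI) metis+
  qed
  have "\<forall>v. \<sigma> v = 1 \<or> \<sigma> v = -1" by (simp add: \<sigma>_def)
  with main show ?thesis unfolding signing_def by (intro exI[of _ \<sigma>] conjI allI) simp_all
qed

text \<open>If neither constant choice of signs works, some \<open>a\<close> forbids
  \<open>card I - 1\<close> and some \<open>b\<close> forbids its negative. Opposite signs at
  \<open>a\<close> and \<open>b\<close> cancel for all other indices, keep \<open>a\<close> and
  \<open>b\<close> away from these extreme values, and leave the same problem on \<open>J\<close>.
  The signs will be weights of edges from one vertex to its neighbours \<open>I\<close>.\<close>

lemma sign_choice:
  fixes g :: "'a \<Rightarrow> int"
  assumes "finite I" "card I \<ge> 2"
  shows "\<exists>s. (\<forall>i. s i = 1 \<or> s i = -1) \<and> (\<forall>i\<in>I. sum s I - s i \<noteq> g i)"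
  using assms
proof (induction "card I" arbitrary: I rule: less_induct)
  case less
  have all: "sum s I - s i = c * (int (card I) - 1)" if "i \<in> I" "\<And>j. j \<in> I \<Longrightarrow> s j = c" for s :: "'a \<Rightarrow> int" and i c
    using that by (simp add: algebra_simps)
  show ?case
  proof (cases "(\<exists>a\<in>I. g a = int (card I) - 1) \<and> (\<exists>b\<in>I. g b = - (int (card I) - 1))")
    case False
    then obtain c :: int where c: "c = 1 \<or> c = -1" "\<forall>i\<in>I. c * (int (card I) - 1) \<noteq> g i" by force
    then show ?thesis using all[of _ "\<lambda>_. c" c] by (intro exI[of _ "\<lambda>_. c"]) auto
  next
    case True
    then obtain a b where ab: "a \<in> I" "b \<in> I" "g a = int (card I) - 1" "g b = - (int (card I) - 1)" by blast
    then have ne: "a \<noteq> b" using less.prems by auto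
    define J where "J = I - {a, b}"
    have J: "finite J" "I = insert a (insert b J)" "a \<notin> J" "b \<notin> J" "card I = card J + 2"
      using less.prems ab ne by (auto simp: J_def card_Diff_insert)
    have IJ: "sum s I = s a + s b + sum s J" for s :: "'a \<Rightarrow> int"
      unfolding J(2) using J ne by simp
    have bnd: "\<bar>sum s J\<bar> \<le> int (card J)" if "\<And>i. s i = 1 \<or> s i = (-1::int)" for s
    proof -
      have "\<bar>sum s J\<bar> \<le> (\<Sum>i\<in>J. \<bar>s i\<bar>)" by (rule sum_abs)
      also have "\<dots> = (\<Sum>i\<in>J. 1)" using that by (intro sum.cong refl) (metis abs_minus_cancel abs_one)
      finally show ?thesis by simp
    qed
    show ?thesis
    proof (cases "card J = 1")
      case True
      then obtain k where k: "J = {k}" by (auto simp: card_1_singleton_iff)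
      have "\<exists>t :: int. (t = 1 \<or> t = -1) \<and> 2 * t \<noteq> g k"
        by (cases "g k = 2") (rule exI[of _ "-1"], simp, rule exI[of _ 1], simp)
      then obtain t :: int where t: "t = 1 \<or> t = -1" "2 * t \<noteq> g k" by blast
      \<comment> \<open>Opposite signs at \<open>a\<close> and \<open>b\<close> would leave the
        single index \<open>k\<close> with the partial sum 0, which \<open>g k\<close> may forbid.
        The choice here gives 0 at \<open>a\<close> and \<open>b\<close>, where 2 and -2 are
        forbidden, and \<open>2 * t\<close> at \<open>k\<close>.\<close>
      define s where "s i = (if i = k then - t else t)" for i
      have "k \<noteq> a" "k \<noteq> b" using J k by auto
      then have "\<forall>i\<in>I. sum s I - s i \<noteq> g i"
        using t ab ne IJ[of s] True J(5) by (auto simp: J(2) k s_def)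
      then show ?thesis using t by (intro exI[of _ s]) (auto simp: s_def)
    next
      case False
      obtain s where s: "\<And>i. s i = 1 \<or> s i = (-1::int)" "\<And>i. i \<in> J \<Longrightarrow> sum s J - s i \<noteq> g i"
      proof (cases "card J = 0")
        case True
        then show ?thesis using that[of "\<lambda>_. 1"] J by simp
      next
        case f: False
        then have "card J \<ge> 2" using False by linarith
        then show ?thesis using less.hyps[of J] J that by auto
      qed
      define s' where "s' = s(a := 1, b := -1)"
      have sJ: "sum s' J = sum s J" using J by (intro sum.cong) (auto simp: s'_def)
      have "sum s' I - s' i \<noteq> g i" if "i \<in> I" for i
      proof -
        consider "i = a" | "i = b" | "i \<in> J" using \<open>i \<in> I\<close> J(2) by blast
        then show ?thesis
        proof cases
          case 1 then show ?thesis using bnd[of s] s ab IJ[of s'] sJ J ne by (auto simp: s'_def)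
        next
          case 2 then show ?thesis using bnd[of s] s ab IJ[of s'] sJ J ne by (auto simp: s'_def)
        next
          case 3
          then have "i \<noteq> a" "i \<noteq> b" using J by auto
          then show ?thesis using s(2)[OF 3] IJ[of s'] sJ ne by (auto simp: s'_def)
        qed
      qed
      moreover have "s' i = 1 \<or> s' i = -1" for i using s(1)[of i] by (auto simp: s'_def)
      ultimately show ?thesis by blast
    qed
  qed
qed

subsection \<open>Distinguishing weightings of regular graphs\<close>

lemma rtranclp_leaves:
  assumes "r\<^sup>*\<^sup>* a b" "a \<in> D" "b \<notin> D"
  shows "\<exists>y x. y \<in> D \<and> x \<notin> D \<and> r y x"
  using assms by (induction rule: converse_rtranclp_induct) blast+

locale regular_graph_on =
  fixes V :: "'a set" and E :: "'a \<Rightarrow> 'a \<Rightarrow> bool" and d :: nat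
  assumes fin: "finite V"
    and E_sym: "E u w \<Longrightarrow> E w u"
    and E_irr: "\<not> E u u"
    and E_V: "E u w \<Longrightarrow> u \<in> V"
    and deg: "v \<in> V \<Longrightarrow> card {w\<in>V. E v w} = d"
    and conn: "u \<in> V \<Longrightarrow> w \<in> V \<Longrightarrow> E\<^sup>*\<^sup>* u w"
begin

lemma E_V2: "E u w \<Longrightarrow> w \<in> V"
  using E_sym E_V by blast

lemma symp_E: "symp E" and irreflp_E: "irreflp E"
  using E_sym E_irr by (auto intro: sympI irreflpI)

definition weighting :: "('a \<Rightarrow> 'a \<Rightarrow> int) \<Rightarrow> bool" where
  "weighting x \<longleftrightarrow> (\<forall>u w. x w u = x u w) \<and> (\<forall>u w. x u w \<noteq> 0 \<longrightarrow> E u w) \<and> (\<forall>u w. \<bar>x u w\<bar> \<le> 1)"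

definition distinguishing :: "('a \<Rightarrow> 'a \<Rightarrow> int) \<Rightarrow> bool" where
  "distinguishing x \<longleftrightarrow> weighting x \<and> (\<forall>u w. E u w \<longrightarrow> (\<Sum>t\<in>V. x u t) \<noteq> (\<Sum>t\<in>V. x w t))"

lemma weightingI:
  assumes "\<And>u w. x w u = x u w" "\<And>u w. x u w \<noteq> 0 \<Longrightarrow> E u w" "\<And>u w. \<bar>x u w\<bar> \<le> 1"
  shows "weighting x"
  using assms unfolding weighting_def by blast

lemma weightingD:
  assumes "weighting x"
  shows "x w u = x u w" "\<not> E u w \<Longrightarrow> x u w = 0" "\<bar>x u w\<bar> \<le> 1"
  using assms unfolding weighting_def by blast+

text \<open>Take a largest independent set that contains the root and is connected to it through
  edges leaving the set. If it did not dominate, connectivity of the graph would give an undominated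
  \<open>x\<close> next to a dominated \<open>y\<close>; adding \<open>x\<close> keeps independence,
  and \<open>x\<close> is reached through \<open>y\<close>.\<close>

lemma connected_independent_set:
  assumes \<rho>: "\<rho> \<in> V"
  obtains U where "U \<subseteq> V" "\<rho> \<in> U" "\<And>u w. u \<in> U \<Longrightarrow> w \<in> U \<Longrightarrow> \<not> E u w"
    "\<And>v. v \<in> V - U \<Longrightarrow> \<exists>u\<in>U. E v u"
    "\<And>v. v \<in> V \<Longrightarrow> (\<lambda>u w. E u w \<and> (u \<in> U) \<noteq> (w \<in> U))\<^sup>*\<^sup>* v \<rho>"
proof -
  define B where "B U u w \<longleftrightarrow> E u w \<and> (u \<in> U) \<noteq> (w \<in> U)" for U u w
  define P where "P U \<longleftrightarrow> U \<subseteq> V \<and> \<rho> \<in> U \<and> (\<forall>u\<in>U. \<forall>w\<in>U. \<not> E u w) \<and> (\<forall>u\<in>U. (B U)\<^sup>*\<^sup>* u \<rho>)" for U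
  have "P {\<rho>}" using \<rho> E_irr by (auto simp: P_def)
  moreover have "\<forall>U. P U \<longrightarrow> card U < Suc (card V)"
    using fin by (auto simp: P_def less_Suc_eq_le intro: card_mono)
  ultimately obtain U where PU: "P U" and max: "\<And>U'. P U' \<Longrightarrow> card U' \<le> card U"
    using ex_has_greatest_nat[of P "{\<rho>}" card "Suc (card V)"] by blast
  have U: "U \<subseteq> V" "\<rho> \<in> U" "\<And>u w. u \<in> U \<Longrightarrow> w \<in> U \<Longrightarrow> \<not> E u w" "\<And>u. u \<in> U \<Longrightarrow> (B U)\<^sup>*\<^sup>* u \<rho>"
    using PU unfolding P_def by blast+
  define D where "D = U \<union> {v. \<exists>u\<in>U. E v u}"
  have dom: "v \<in> D" if v: "v \<in> V" for v
  proof (rule ccontr)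
    assume "v \<notin> D"
    moreover have "\<rho> \<in> D" using U by (simp add: D_def)
    moreover have "E\<^sup>*\<^sup>* \<rho> v" using conn \<rho> v by blast
    ultimately obtain y x where yx: "y \<in> D" "x \<notin> D" "E y x"
      using rtranclp_leaves[of E \<rho> v D] by blast
    have "y \<notin> U" using yx E_sym unfolding D_def by blast
    then obtain u where u: "u \<in> U" "E y u" using yx unfolding D_def by blast
    have x: "x \<notin> U" "\<And>t. t \<in> U \<Longrightarrow> \<not> E x t" "\<And>t. t \<in> U \<Longrightarrow> \<not> E t x"
      using yx E_sym unfolding D_def by blast+
    \<comment> \<open>As \<open>x\<close> has no neighbour in \<open>U\<close>, moving it into the
      set destroys no edge of the bipartite graph.\<close>
    have mono: "B (insert x U) a b" if "B U a b" for a b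
    proof -
      have "a \<noteq> x" "b \<noteq> x" using that x E_sym by (auto simp: B_def)
      then show ?thesis using that by (auto simp: B_def)
    qed
    have old: "(B (insert x U))\<^sup>*\<^sup>* t \<rho>" if "t \<in> U" for t
      using U(4)[OF that] mono by (rule_tac rtranclp_mono[THEN predicate2D]) auto
    have "B (insert x U) x y" using yx \<open>y \<notin> U\<close> E_sym E_irr by (auto simp: B_def)
    moreover have "B (insert x U) y u" using u \<open>y \<notin> U\<close> yx E_irr by (auto simp: B_def)
    ultimately have new: "(B (insert x U))\<^sup>*\<^sup>* x \<rho>"
      using old[OF u(1)] by (meson converse_rtranclp_into_rtranclp)
    have "P (insert x U)"
      unfolding P_def using U x E_irr E_V2[OF yx(3)] old new by auto
    moreover have "finite U" using U fin finite_subset by blast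
    ultimately show False using max[of "insert x U"] x by simp
  qed
  have reach: "(B U)\<^sup>*\<^sup>* v \<rho>" if v: "v \<in> V" for v
  proof (cases "v \<in> U")
    case False
    then obtain u where "u \<in> U" "E v u" using dom[OF v] by (auto simp: D_def)
    then have "B U v u" using False by (simp add: B_def)
    then show ?thesis using U(4)[OF \<open>u \<in> U\<close>] by (rule converse_rtranclp_into_rtranclp)
  qed (use U in blast)
  show ?thesis
  proof (rule that[of U])
    show "\<exists>u\<in>U. E v u" if "v \<in> V - U" for v using dom[of v] that by (auto simp: D_def)
    show "(\<lambda>u w. E u w \<and> (u \<in> U) \<noteq> (w \<in> U))\<^sup>*\<^sup>* v \<rho>" if "v \<in> V" for v
      using reach[OF that] unfolding B_def[abs_def] .
  qed (use U in blast)+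
qed

text \<open>The signing, applied to the offsets \<open>\<sigma> v * Z v\<close>, moves each value on
  \<open>R\<close> by an even amount in the direction of its sign. Then parity separates
  \<open>R\<close> from the outside, the sign separates the two sides of \<open>\<sigma>\<close>,
  and the signing separates neighbours on one side.\<close>

lemma distinguishing_by_parity_and_sign:
  fixes \<sigma> :: "'a \<Rightarrow> int"
  assumes R: "R \<subseteq> V" and sg: "signing R E \<sigma>"
    and z: "weighting z" "\<And>u w. u \<in> R \<Longrightarrow> w \<in> R \<Longrightarrow> z u w = 0"
    and zR: "\<And>v. v \<in> R \<Longrightarrow> odd (\<Sum>w\<in>V. z v w)" "\<And>v. v \<in> R \<Longrightarrow> \<sigma> v * (\<Sum>w\<in>V. z v w) > 0"
    and even: "\<And>u v. u \<in> V - R \<Longrightarrow> v \<in> R \<Longrightarrow> E u v \<Longrightarrow> even (\<Sum>w\<in>V. z u w)"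
    and outer: "\<And>u v. u \<in> V - R \<Longrightarrow> v \<in> V - R \<Longrightarrow> E u v \<Longrightarrow> (\<Sum>w\<in>V. z u w) \<noteq> (\<Sum>w\<in>V. z v w)"
  shows "\<exists>x. distinguishing x"
proof -
  define Z where "Z v = (\<Sum>w\<in>V. z v w)" for v
  obtain x where x: "\<And>u w. x w u = x u w" "\<And>u w. x u w \<noteq> 0 \<Longrightarrow> u \<in> R \<and> w \<in> R \<and> E u w"
      "\<And>u w. \<bar>x u w\<bar> \<le> 1" "\<And>v. v\<in>R \<Longrightarrow> \<exists>k. \<sigma> v * (\<Sum>w\<in>R. x v w) = 2 * int k"
      "\<And>u w. u \<in> R \<Longrightarrow> w \<in> R \<Longrightarrow> E u w \<Longrightarrow> \<sigma> u = \<sigma> w \<Longrightarrow>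
         \<sigma> u * Z u + \<sigma> u * (\<Sum>t\<in>R. x u t) \<noteq> \<sigma> w * Z w + \<sigma> w * (\<Sum>t\<in>R. x w t)"
    using spec[OF conjunct2[OF sg[unfolded signing_def]], of "\<lambda>v. \<sigma> v * Z v"] by metis
  note \<sigma> = signing_sign[OF sg]
  have XV: "(\<Sum>w\<in>V. x v w) = (\<Sum>w\<in>R. x v w)" for v
    using R fin x(2) by (intro sum.mono_neutral_right) blast+
  have X0: "(\<Sum>w\<in>V. x v w) = 0" if "v \<notin> R" for v
    using x(2) that by (intro sum.neutral) blast
  define y where "y u w = z u w + x u w" for u w
  have val: "(\<Sum>w\<in>V. y v w) = Z v + (\<Sum>w\<in>V. x v w)" for v
    by (simp add: y_def sum.distrib Z_def)
  have "weighting y"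
  proof (rule weightingI)
    show "y w u = y u w" for u w using weightingD(1)[OF z(1), of w u] x(1)[of w u] by (simp add: y_def)
    show "E u w" if "y u w \<noteq> 0" for u w
      using that weightingD(2)[OF z(1), of u w] x(2)[of u w] unfolding y_def by fastforce
    show "\<bar>y u w\<bar> \<le> 1" for u w
    proof (cases "u \<in> R \<and> w \<in> R")
      case True
      then show ?thesis using z(2)[of u w] x(3)[of u w] by (simp add: y_def)
    next
      case False
      then have "x u w = 0" using x(2) by blast
      then show ?thesis using weightingD(3)[OF z(1), of u w] by (simp add: y_def)
    qed
  qed
  have odd_pos: "odd (\<Sum>w\<in>V. y v w) \<and> \<sigma> v * (\<Sum>w\<in>V. y v w) > 0" if v: "v \<in> R" for v
  proof -
    obtain k where k: "\<sigma> v * (\<Sum>w\<in>V. x v w) = 2 * int k" using x(4)[OF v] XV by auto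
    then have "even (\<Sum>w\<in>V. x v w)" using \<sigma>[of v] by (metis dvd_triv_left dvd_minus_iff mult_1 mult_minus1)
    then show ?thesis using zR[OF v] k unfolding val by (simp add: Z_def distrib_left)
  qed
  have out: "(\<Sum>w\<in>V. y v w) = Z v" if "v \<notin> R" for v using val X0[OF that] by simp
  have "(\<Sum>t\<in>V. y u t) \<noteq> (\<Sum>t\<in>V. y w t)" if e: "E u w" for u w
  proof -
    have uw: "u \<in> V" "w \<in> V" using e E_V E_V2 by blast+
    consider "u \<in> R" "w \<in> R" "\<sigma> u = \<sigma> w" | "u \<in> R" "w \<in> R" "\<sigma> u \<noteq> \<sigma> w" | "u \<in> R" "w \<notin> R"
      | "u \<notin> R" "w \<in> R" | "u \<notin> R" "w \<notin> R" by blast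
    then show ?thesis
    proof cases
      case 1
      then have "\<sigma> u * (Z u + (\<Sum>t\<in>R. x u t)) \<noteq> \<sigma> w * (Z w + (\<Sum>t\<in>R. x w t))"
        using x(5)[OF 1(1,2) e 1(3)] by (simp add: distrib_left)
      then show ?thesis using 1(3) unfolding val XV by auto
    next
      case 2
      then show ?thesis using odd_pos[of u] odd_pos[of w] \<sigma>[of u] \<sigma>[of w] by auto
    next
      case 3
      then show ?thesis using odd_pos[of u] out[of w] even[of w u] uw E_sym[OF e] by (auto simp: Z_def)
    next
      case 4
      then show ?thesis using odd_pos[of w] out[of u] even[of u w] uw e by (auto simp: Z_def)
    next
      case 5
      then show ?thesis using outer[of u w] uw e out by (simp add: Z_def)
    qed
  qed
  then show ?thesis using \<open>weighting y\<close> unfolding distinguishing_def by blast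
qed

section \<open>Weightings with prescribed values modulo 3\<close>

lemma mod3_weighting:
  fixes t :: "'a \<Rightarrow> int"
  assumes U: "U \<subseteq> V" "\<rho> \<in> U" and conB: "\<And>v. v \<in> V \<Longrightarrow> (\<lambda>u w. E u w \<and> (u \<in> U) \<noteq> (w \<in> U))\<^sup>*\<^sup>* v \<rho>"
    and t: "[sum t U = sum t (V - U)] (mod 3)"
  shows "\<exists>x. weighting x \<and> (\<forall>u w. x u w \<noteq> 0 \<longrightarrow> (u \<in> U) \<noteq> (w \<in> U)) \<and>
           (\<forall>v\<in>V. [(\<Sum>w\<in>V. x v w) = t v] (mod 3))"
proof -
  define B where "B u w \<longleftrightarrow> E u w \<and> (u \<in> U) \<noteq> (w \<in> U)" for u w
  define \<delta> where "\<delta> = sum t U - sum t (V - U)"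
  \<comment> \<open>Negation on one side of the bipartition turns a symmetric weighting into a flow
    with net outflow \<open>c\<close>. The sides balance only modulo 3, so the root absorbs the
    multiple \<open>\<delta>\<close> of 3.\<close>
  define c where "c v = (if v \<in> U then t v else - t v) - (if v = \<rho> then \<delta> else 0)" for v
  have \<delta>: "3 dvd \<delta>" using t by (simp add: \<delta>_def cong_iff_dvd_diff)
  have "sum c V = (\<Sum>v\<in>V. if v \<in> U then t v else - t v) - \<delta>"
    using fin U by (simp add: c_def sum_subtractf subset_iff)
  also have "(\<Sum>v\<in>V. if v \<in> U then t v else - t v) = \<delta>"
    using sum.subset_diff[OF U(1) fin, of "\<lambda>v. if v \<in> U then t v else - t v"]
    by (simp add: \<delta>_def sum_negf)
  finally have "sum c V = 0" by simp
  then obtain y where y: "skew y" "\<And>u w. \<not> B u w \<Longrightarrow> y u w = 0" "\<And>v. v \<in> V \<Longrightarrow> (\<Sum>w\<in>V. y v w) = c v"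
    using connected_flow[of V B \<rho> c] fin U conB E_sym E_V E_irr unfolding B_def by blast
  \<comment> \<open>\<open>m k\<close> is the representative of \<open>k\<close> modulo 3 among -1,
    0 and 1.\<close>
  define m where "m k = (k + 1) mod 3 - 1" for k :: int
  have m: "[m k = k] (mod 3)" "\<bar>m k\<bar> \<le> 1" "m 0 = 0" for k
    by (auto simp: m_def cong_def mod_diff_left_eq)
  define x where "x u w = m (if u \<in> U then y u w else - y u w)" for u w
  have xB: "B u w" if "x u w \<noteq> 0" for u w
    using that y(2)[of u w] m(3) unfolding x_def by (cases "B u w") (auto split: if_splits)
  have "weighting x"
  proof (rule weightingI)
    show "x w u = x u w" for u w
    proof (cases "B u w")
      case True
      then show ?thesis using skewD[OF y(1), of w u] by (auto simp: x_def B_def)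
    next
      case False
      then have "\<not> B w u" using E_sym by (auto simp: B_def)
      then show ?thesis using False xB by metis
    qed
    show "E u w" if "x u w \<noteq> 0" for u w using xB[OF that] by (simp add: B_def)
    show "\<bar>x u w\<bar> \<le> 1" for u w unfolding x_def by (rule m)
  qed
  moreover have "(u \<in> U) \<noteq> (w \<in> U)" if "x u w \<noteq> 0" for u w using xB[OF that] by (simp add: B_def)
  moreover have "[(\<Sum>w\<in>V. x v w) = t v] (mod 3)" if v: "v \<in> V" for v
  proof -
    have "[(\<Sum>w\<in>V. x v w) = (\<Sum>w\<in>V. if v \<in> U then y v w else - y v w)] (mod 3)"
      unfolding x_def by (intro cong_sum m)
    also have "(\<Sum>w\<in>V. if v \<in> U then y v w else - y v w) = (if v \<in> U then c v else - c v)"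
      using y(3)[OF v] by (simp add: sum_negf)
    also have "[\<dots> = t v] (mod 3)"
      using \<delta> by (auto simp: c_def cong_iff_dvd_diff)
    finally show ?thesis .
  qed
  ultimately show ?thesis by (intro exI[of _ x]) blast
qed

text \<open>Modulo 3 the values are to be 0 on \<open>U\<close> and \<open>\<tau>\<close> elsewhere.
  Weights on the bipartite edges achieve this if \<open>\<tau>\<close> sums to 0 modulo 3 outside
  \<open>U\<close>; if not, an edge \<open>a b\<close> outside \<open>U\<close> takes weight
  \<open>\<epsilon>\<close> and lowers the sum still required by
  \<open>2 * \<epsilon>\<close>.\<close>

lemma distinguishing_mod3:
  fixes \<tau> :: "'a \<Rightarrow> int"
  assumes U: "U \<subseteq> V" "\<rho> \<in> U" "\<And>u w. u \<in> U \<Longrightarrow> w \<in> U \<Longrightarrow> \<not> E u w"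
    and conB: "\<And>v. v \<in> V \<Longrightarrow> (\<lambda>u w. E u w \<and> (u \<in> U) \<noteq> (w \<in> U))\<^sup>*\<^sup>* v \<rho>"
    and \<tau>: "\<And>v. \<tau> v = 1 \<or> \<tau> v = 2" "\<And>u w. u \<notin> U \<Longrightarrow> w \<notin> U \<Longrightarrow> E u w \<Longrightarrow> \<tau> u \<noteq> \<tau> w"
    and e: "3 dvd sum \<tau> (V - U) \<or> (\<exists>a b. a \<notin> U \<and> b \<notin> U \<and> E a b)"
  shows "\<exists>x. distinguishing x"
proof -
  obtain a b where ab: "3 dvd sum \<tau> (V - U) \<or> (a \<notin> U \<and> b \<notin> U \<and> E a b)" using e by blast
  define \<epsilon> :: int where "\<epsilon> = (if 3 dvd sum \<tau> (V - U) then 0 else (1 - sum \<tau> (V - U)) mod 3 - 1)"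
  have \<epsilon>: "\<bar>\<epsilon>\<bar> \<le> 1" "3 dvd (sum \<tau> (V - U) - 2 * \<epsilon>)" unfolding \<epsilon>_def by presburger+
  have ab': "a \<notin> U" "b \<notin> U" "E a b" "a \<noteq> b" "a \<in> V" "b \<in> V" if "\<epsilon> \<noteq> 0"
    using ab that E_irr E_V E_V2 by (auto simp: \<epsilon>_def split: if_splits)
  define f where "f u w = (if (u = a \<and> w = b) \<or> (u = b \<and> w = a) then \<epsilon> else 0)" for u w
  define t where "t v = (if v \<in> U then 0 else \<tau> v) - (if v = a \<or> v = b then \<epsilon> else 0)" for v
  have fsum: "(\<Sum>w\<in>V. f v w) = (if v = a \<or> v = b then \<epsilon> else 0)" if "v \<in> V" for v
  proof (cases "\<epsilon> = 0")
    case True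
    then have "f v w = 0" for w by (simp add: f_def)
    then show ?thesis using True by simp
  next
    case False
    have "(\<Sum>w\<in>V. f v w) = (\<Sum>w\<in>V. if w = (if v = a then b else a) then (if v = a \<or> v = b then \<epsilon> else 0) else 0)"
      using ab'(4)[OF False] by (intro sum.cong refl) (auto simp: f_def)
    then show ?thesis using ab'[OF False] fin by simp
  qed
  have "[sum t U = sum t (V - U)] (mod 3)"
  proof (cases "\<epsilon> = 0")
    case True
    have "sum t U = 0" using True by (intro sum.neutral) (simp add: t_def)
    moreover have "sum t (V - U) = sum \<tau> (V - U)" using True by (intro sum.cong refl) (simp add: t_def)
    ultimately show ?thesis using \<epsilon>(2) True by (simp add: cong_iff_dvd_diff)
  next
    case False
    note ab' = ab'[OF False]
    have "sum t U = 0" using ab' by (intro sum.neutral) (auto simp: t_def)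
    moreover have "sum t (V - U) = sum \<tau> (V - U) - (\<Sum>v\<in>V-U. if v = a \<or> v = b then \<epsilon> else 0)"
      unfolding sum_subtractf[symmetric] by (intro sum.cong refl) (simp add: t_def)
    moreover have "(\<Sum>v\<in>V-U. if v = a \<or> v = b then \<epsilon> else 0)
        = (\<Sum>v\<in>V-U. (if v = a then \<epsilon> else 0) + (if v = b then \<epsilon> else 0))"
      using ab' by (intro sum.cong refl) auto
    then have "(\<Sum>v\<in>V-U. if v = a \<or> v = b then \<epsilon> else 0) = 2 * \<epsilon>"
      using ab' fin by (simp add: sum.distrib)
    moreover have "[0 = sum \<tau> (V - U) - 2 * \<epsilon>] (mod 3)" using \<epsilon>(2) by (metis cong_0_iff cong_sym)
    ultimately show ?thesis by simp
  qed
  then obtain x where x: "weighting x" "\<And>u w. x u w \<noteq> 0 \<Longrightarrow> (u \<in> U) \<noteq> (w \<in> U)"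
      "\<And>v. v \<in> V \<Longrightarrow> [(\<Sum>w\<in>V. x v w) = t v] (mod 3)"
    using mod3_weighting[OF U(1,2) conB, of t] by blast
  define y where "y u w = x u w + f u w" for u w
  have xf: "x u w = 0 \<or> f u w = 0" for u w
    using x(2)[of u w] ab' by (auto simp: f_def)
  have fE: "E u w" if "f u w \<noteq> 0" for u w
    using that ab'(3) E_sym by (auto simp: f_def split: if_splits)
  have "weighting y"
  proof (rule weightingI)
    show "y w u = y u w" for u w
      using weightingD(1)[OF x(1), of w u] by (auto simp: y_def f_def)
    show "E u w" if "y u w \<noteq> 0" for u w
      using that weightingD(2)[OF x(1), of u w] fE[of u w] by (cases "E u w") (auto simp: y_def)
    show "\<bar>y u w\<bar> \<le> 1" for u w
      using xf[of u w] weightingD(3)[OF x(1), of u w] \<epsilon>(1) by (auto simp: y_def f_def)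
  qed
  have val: "[(\<Sum>w\<in>V. y v w) = (if v \<in> U then 0 else \<tau> v)] (mod 3)" if "v \<in> V" for v
  proof -
    have "(\<Sum>w\<in>V. y v w) = (\<Sum>w\<in>V. x v w) + (if v = a \<or> v = b then \<epsilon> else 0)"
      using fsum[OF that] by (simp add: y_def sum.distrib)
    then show ?thesis
      using cong_add[OF x(3)[OF that], of "if v = a \<or> v = b then \<epsilon> else 0" "if v = a \<or> v = b then \<epsilon> else 0"]
      by (simp add: t_def)
  qed
  have "(\<Sum>s\<in>V. y u s) \<noteq> (\<Sum>s\<in>V. y w s)" if e: "E u w" for u w
  proof
    assume eq: "(\<Sum>s\<in>V. y u s) = (\<Sum>s\<in>V. y w s)"
    have "u \<in> V" "w \<in> V" using e E_V E_V2 by blast+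
    then have "[(if u \<in> U then 0 else \<tau> u) = (if w \<in> U then 0 else \<tau> w)] (mod 3)"
      using val[of u] val[of w] eq by (metis cong_sym cong_trans)
    then show False using \<tau>(1)[of u] \<tau>(1)[of w] \<tau>(2)[OF _ _ e] U(3)[of u w] e
      by (auto simp: cong_def split: if_splits)
  qed
  then show ?thesis using \<open>weighting y\<close> unfolding distinguishing_def by blast
qed

end

lemma double_count:
  assumes "finite K" "finite L" "\<And>u z. P u z = Q z u"
  shows "(\<Sum>u\<in>K. card {z\<in>L. P u z}) = (\<Sum>z\<in>L. card {u\<in>K. Q z u})"
proof -
  have "(\<Sum>u\<in>K. card {z\<in>L. P u z}) = (\<Sum>u\<in>K. \<Sum>z\<in>L. if Q z u then 1 else 0)"
    using assms by (intro sum.cong refl) (simp add: sum.inter_filter[symmetric])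
  also have "\<dots> = (\<Sum>z\<in>L. \<Sum>u\<in>K. if Q z u then 1 else 0)" by (rule sum.swap)
  also have "\<dots> = (\<Sum>z\<in>L. card {u\<in>K. Q z u})"
    using assms by (intro sum.cong refl) (simp add: sum.inter_filter[symmetric])
  finally show ?thesis .
qed

section \<open>The connected bipartite graph between an independent set and its complement\<close>

locale independent_split = regular_graph_on +
  fixes U :: "'a set" and \<rho> :: 'a
  assumes U_V: "U \<subseteq> V" and \<rho>_U: "\<rho> \<in> U"
    and U_indep: "u \<in> U \<Longrightarrow> w \<in> U \<Longrightarrow> \<not> E u w"
    and U_dom: "v \<in> V - U \<Longrightarrow> \<exists>u\<in>U. E v u"
    and conB: "v \<in> V \<Longrightarrow> (\<lambda>u w. E u w \<and> (u \<in> U) \<noteq> (w \<in> U))\<^sup>*\<^sup>* v \<rho>"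
begin

definition B :: "'a \<Rightarrow> 'a \<Rightarrow> bool" where
  "B u w \<longleftrightarrow> E u w \<and> (u \<in> U) \<noteq> (w \<in> U)"

definition h :: "'a \<Rightarrow> nat" where
  "h v = card {u\<in>U. E v u}"

lemma B_sym: "B u w \<Longrightarrow> B w u"
  using E_sym by (auto simp: B_def)

lemma B_V: "B u w \<Longrightarrow> u \<in> V"
  using E_V by (auto simp: B_def)

lemma B_V2: "B u w \<Longrightarrow> w \<in> V"
  using E_V2 by (auto simp: B_def)

lemma B_irr: "\<not> B u u"
  by (simp add: B_def)

lemma B_reach: "v \<in> V \<Longrightarrow> B\<^sup>*\<^sup>* v \<rho>"
  using conB unfolding B_def[abs_def] .

lemma \<rho>_V: "\<rho> \<in> V"
  using \<rho>_U U_V by blast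

lemma fin_U: "finite U"
  using U_V fin finite_subset by blast

text \<open>Every edge of \<open>F\<close> carries the sign of its end outside \<open>U\<close>. So
  a vertex outside \<open>U\<close> gets an odd multiple of its sign, while a vertex of
  \<open>U\<close> adds up an even number of signs.\<close>

lemma distinguishing_even:
  assumes "even (card (V - U))"
  shows "\<exists>x. distinguishing x"
proof -
  have finR: "finite (V - U)" using fin by simp
  obtain \<sigma> where sg: "signing (V - U) E \<sigma>" using ex_signing[OF finR symp_E irreflp_E] by blast
  note \<sigma> = signing_sign[OF sg]
  have "\<exists>F. (\<forall>u w. F u w \<longrightarrow> B u w) \<and> (\<forall>u w. F u w \<longrightarrow> F w u) \<and>
           (\<forall>v\<in>V. odd (card {w\<in>V. F v w}) \<longleftrightarrow> v \<in> V - U)"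
    by (rule tjoin) (rule fin B_irr \<rho>_V Diff_subset assms | erule B_sym B_V B_reach)+
  then obtain F where F: "\<And>u w. F u w \<Longrightarrow> B u w" "\<And>u w. F u w \<Longrightarrow> F w u"
      "\<And>v. v \<in> V \<Longrightarrow> odd (card {w\<in>V. F v w}) \<longleftrightarrow> v \<in> V - U"
    by blast
  define z where "z u w = (if F u w then if u \<in> U then \<sigma> w else \<sigma> u else 0)" for u w
  have ZR: "(\<Sum>w\<in>V. z v w) = \<sigma> v * int (card {w\<in>V. F v w})" if "v \<in> V - U" for v
    using that fin by (simp add: z_def sum.inter_filter[symmetric])
  have odd_\<sigma>: "odd (\<sigma> v)" for v using \<sigma>[of v] by auto
  have ZU: "even (\<Sum>w\<in>V. z u w)" if "u \<in> U" for u
  proof -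
    have "{w\<in>V. odd (z u w)} = {w\<in>V. F u w}" using odd_\<sigma> by (auto simp: z_def)
    then show ?thesis using F(3)[of u] that U_V even_sum_card_odd[OF fin, of "z u"] by auto
  qed
  show ?thesis
  proof (rule distinguishing_by_parity_and_sign[of "V - U" \<sigma> z])
    show "weighting z"
    proof (rule weightingI)
      show "z w u = z u w" for u w
        using F(1)[of u w] F(2)[of u w] F(2)[of w u] by (cases "F u w") (auto simp: z_def B_def)
      show "E u w" if "z u w \<noteq> 0" for u w
        using that F(1)[of u w] by (auto simp: z_def B_def split: if_splits)
      show "\<bar>z u w\<bar> \<le> 1" for u w
        using \<sigma>[of u] \<sigma>[of w] by (auto simp: z_def)
    qed
    show "z u w = 0" if "u \<in> V - U" "w \<in> V - U" for u w
      using that F(1)[of u w] by (auto simp: z_def B_def)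
    show "odd (\<Sum>w\<in>V. z v w)" if "v \<in> V - U" for v
      using ZR[OF that] F(3)[of v] that \<sigma>[of v] by auto
    show "0 < \<sigma> v * (\<Sum>w\<in>V. z v w)" if v: "v \<in> V - U" for v
    proof -
      have "card {w\<in>V. F v w} > 0" using F(3)[of v] v by (intro odd_pos) auto
      then show ?thesis unfolding ZR[OF v] using \<sigma>[of v] by auto
    qed
    show "even (\<Sum>w\<in>V. z u w)" if "u \<in> V - (V - U)" for u using that ZU by auto
    show "(\<Sum>w\<in>V. z u w) \<noteq> (\<Sum>w\<in>V. z v w)" if "u \<in> V - (V - U)" "v \<in> V - (V - U)" "E u v" for u v
      using that U_indep by auto
  qed (use sg in auto)
qed

end

text \<open>All edges at the exceptional vertex \<open>r\<close> lie outside \<open>R\<close>, so their weights are free.\<close>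

locale exceptional_vertex = independent_split +
  fixes r :: 'a and \<sigma> :: "'a \<Rightarrow> int" and R :: "'a set"
  assumes r: "r \<in> V" "r \<notin> U"
    and R_def: "R = V - U - {r}"
    and evenR: "even (card R)"
    and sg: "signing R E \<sigma>"
begin

definition B' :: "'a \<Rightarrow> 'a \<Rightarrow> bool" where
  "B' u w \<longleftrightarrow> B u w \<and> u \<noteq> r \<and> w \<noteq> r"

text \<open>A T-join of the bipartite graph with \<open>r\<close> deleted, where the predicate
  \<open>T\<close> prescribes the odd vertices.\<close>

definition join :: "('a \<Rightarrow> bool) \<Rightarrow> ('a \<Rightarrow> 'a \<Rightarrow> bool) \<Rightarrow> bool" where
  "join T F \<longleftrightarrow> (\<forall>u w. F u w \<longrightarrow> B' u w) \<and> (\<forall>u w. F u w \<longrightarrow> F w u) \<and>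
     (\<forall>v\<in>V - {r}. odd (card {w\<in>V. F v w}) \<longleftrightarrow> T v)"

text \<open>The value that \<open>u\<close> in \<open>U\<close> receives if each edge of
  \<open>F\<close> carries the sign of its end outside \<open>U\<close>.\<close>

definition \<gamma> :: "('a \<Rightarrow> 'a \<Rightarrow> bool) \<Rightarrow> 'a \<Rightarrow> int" where
  "\<gamma> F u = (\<Sum>w\<in>V. if F u w then \<sigma> w else 0)"

lemma B'_sym: "B' u w \<Longrightarrow> B' w u"
  using B_sym by (auto simp: B'_def)

lemma R_V: "R \<subseteq> V" "finite R"
  using fin by (auto simp: R_def)

lemmas \<sigma> = signing_sign[OF sg]

lemma odd_\<sigma>: "odd (\<sigma> v)"
  using \<sigma>[of v] by auto

text \<open>\<open>A\<close> collects the neighbours of \<open>r\<close> whose edge to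
  \<open>r\<close> has nonzero weight: the sign \<open>\<sigma>\<close> of an end in
  \<open>R\<close>, a free sign \<open>s\<close> for an end in \<open>U\<close>. Flipping the
  parities required of \<open>F\<close> on \<open>A\<close> compensates for these edges. As
  \<open>card A\<close> is even, \<open>r\<close> is even like all of \<open>U\<close>, and only
  collisions between \<open>r\<close> and its neighbours in \<open>U\<close> remain to be
  excluded.\<close>

lemma distinguishing_from_join:
  assumes A: "\<And>a. a \<in> A \<Longrightarrow> E r a" "even (card A)"
    and F: "join (\<lambda>v. (v \<in> R) \<noteq> (v \<in> A)) F"
    and s: "\<And>u. s u = 1 \<or> s u = (-1::int)"
    and neq: "\<And>u. u \<in> U \<Longrightarrow> E r u \<Longrightarrow>
      sum s (A \<inter> U) + sum \<sigma> (A - U) \<noteq> \<gamma> F u + (if u \<in> A then s u else 0)"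
  shows "\<exists>x. distinguishing x"
proof -
  have FB: "\<And>u w. F u w \<Longrightarrow> B' u w" and Fs: "\<And>u w. F u w \<Longrightarrow> F w u"
    and Fo: "\<And>v. v \<in> V - {r} \<Longrightarrow> odd (card {w\<in>V. F v w}) \<longleftrightarrow> (v \<in> R) \<noteq> (v \<in> A)"
    using F unfolding join_def by blast+
  have AV: "A \<subseteq> V" "r \<notin> A" using A E_V2 E_irr by blast+
  have finA: "finite A" using AV fin finite_subset by blast
  define \<tau> where "\<tau> v = (if v \<in> U then s v else \<sigma> v)" for v
  have \<tau>: "\<tau> v = 1 \<or> \<tau> v = -1" for v using s[of v] \<sigma>[of v] by (auto simp: \<tau>_def)
  have odd_\<tau>: "odd (\<tau> v)" for v using \<tau>[of v] by auto
  define f where "f u w = (if F u w then if u \<in> U then \<sigma> w else \<sigma> u else 0)" for u w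
  define g where "g u w = (if u = r \<and> w \<in> A then \<tau> w else if w = r \<and> u \<in> A then \<tau> u else 0)" for u w
  define z where "z u w = f u w + g u w" for u w
  have fr: "f u r = 0" "f r u = 0" for u using FB[of u r] FB[of r u] by (auto simp: f_def B'_def)
  have g0: "g u w = 0" if "u \<noteq> r" "w \<noteq> r" for u w using that by (simp add: g_def)
  have zs: "(\<Sum>w\<in>V. z u w) = (\<Sum>w\<in>V. f u w) + (\<Sum>w\<in>V. g u w)" for u
    by (simp add: z_def sum.distrib)
  have gv: "(\<Sum>w\<in>V. g v w) = (if v \<in> A then \<tau> v else 0)" if "v \<noteq> r" for v
  proof -
    have "(\<Sum>w\<in>V. g v w) = (\<Sum>w\<in>V. if w = r then (if v \<in> A then \<tau> v else 0) else 0)"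
      using that by (intro sum.cong refl) (simp add: g_def)
    then show ?thesis using r fin by simp
  qed
  have gr: "(\<Sum>w\<in>V. g r w) = sum \<tau> A"
  proof -
    have "(\<Sum>w\<in>V. g r w) = (\<Sum>w\<in>V. if w \<in> A then \<tau> w else 0)"
      using AV by (intro sum.cong refl) (simp add: g_def)
    also have "\<dots> = sum \<tau> (V \<inter> A)" using fin by (simp add: sum.inter_restrict)
    also have "V \<inter> A = A" using AV by blast
    finally show ?thesis .
  qed
  have fR: "(\<Sum>w\<in>V. f v w) = \<sigma> v * int (card {w\<in>V. F v w})" if "v \<in> R" for v
    using that fin by (simp add: f_def R_def sum.inter_filter[symmetric])
  have fU: "(\<Sum>w\<in>V. f u w) = \<gamma> F u" if "u \<in> U" for u
    using that by (simp add: f_def \<gamma>_def cong: if_cong)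
  have ZR: "(\<Sum>w\<in>V. z v w) = \<sigma> v * int (card {w\<in>V. F v w} + of_bool (v \<in> A))" if "v \<in> R" for v
    using that fR[OF that] gv[of v] by (auto simp: zs R_def \<tau>_def algebra_simps)
  have oddR: "odd (card {w\<in>V. F v w} + of_bool (v \<in> A))" if "v \<in> R" for v
    using Fo[of v] that by (auto simp: R_def)
  have ZU: "(\<Sum>w\<in>V. z u w) = \<gamma> F u + (if u \<in> A then s u else 0)" if "u \<in> U" for u
  proof -
    have "u \<noteq> r" using that r by blast
    then show ?thesis using that fU[OF that] gv[of u] by (simp add: zs \<tau>_def)
  qed
  have evU: "even (\<Sum>w\<in>V. z u w)" if u: "u \<in> U" for u
  proof -
    have "{w\<in>V. odd (f u w)} = {w\<in>V. F u w}" using odd_\<sigma> u by (auto simp: f_def)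
    then have "even (\<gamma> F u) \<longleftrightarrow> even (card {w\<in>V. F u w})"
      using even_sum_card_odd[OF fin, of "f u"] fU[OF u] by simp
    moreover have "u \<noteq> r" "u \<in> V" "u \<notin> R" using u r U_V by (auto simp: R_def)
    ultimately have "even (\<gamma> F u) \<longleftrightarrow> u \<notin> A" using Fo[of u] by auto
    then show ?thesis using s[of u] by (auto simp: ZU[OF u])
  qed
  have Zr: "(\<Sum>w\<in>V. z r w) = sum s (A \<inter> U) + sum \<sigma> (A - U)"
  proof -
    have "sum \<tau> A = sum \<tau> (A \<inter> U) + sum \<tau> (A - U)"
      using finA by (metis Int_Diff_disjoint Un_Diff_Int finite_Diff finite_Int inf_commute sum.union_disjoint sup_commute)
    also have "sum \<tau> (A \<inter> U) = sum s (A \<inter> U)" by (intro sum.cong refl) (simp add: \<tau>_def)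
    also have "sum \<tau> (A - U) = sum \<sigma> (A - U)" by (intro sum.cong refl) (simp add: \<tau>_def)
    finally show ?thesis using fr gr by (simp add: zs)
  qed
  have evr: "even (\<Sum>w\<in>V. z r w)"
  proof -
    have "{w\<in>A. odd (\<tau> w)} = A" using odd_\<tau> by auto
    then have "even (sum \<tau> A)" using even_sum_card_odd[OF finA, of \<tau>] A(2) by simp
    then show ?thesis using fr gr by (simp add: zs)
  qed
  have VR: "V - R = insert r U" using r U_V by (auto simp: R_def)
  show ?thesis
  proof (rule distinguishing_by_parity_and_sign[of R \<sigma> z])
    show "weighting z"
    proof (rule weightingI)
      have "f w u = f u w" for u w
        using FB[of u w] Fs[of u w] Fs[of w u] by (cases "F u w") (auto simp: f_def B'_def B_def)
      moreover have "g w u = g u w" for u w using AV by (auto simp: g_def)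
      ultimately show "z w u = z u w" for u w by (simp add: z_def)
      show "E u w" if "z u w \<noteq> 0" for u w
      proof -
        have "f u w \<noteq> 0 \<or> g u w \<noteq> 0" using that by (auto simp: z_def)
        then show ?thesis using FB[of u w] A(1)[of u] A(1)[of w] E_sym
          by (auto simp: f_def g_def B'_def B_def split: if_splits)
      qed
      show "\<bar>z u w\<bar> \<le> 1" for u w
      proof (cases "u = r \<or> w = r")
        case True
        then have "f u w = 0" using fr by auto
        then show ?thesis using \<tau>[of u] \<tau>[of w] by (auto simp: z_def g_def)
      next
        case False
        then show ?thesis using g0[of u w] \<sigma>[of u] \<sigma>[of w] by (auto simp: z_def f_def)
      qed
    qed
    show "z u w = 0" if "u \<in> R" "w \<in> R" for u w
      using that FB[of u w] g0[of u w] by (auto simp: z_def f_def R_def B'_def B_def)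
    show "odd (\<Sum>w\<in>V. z v w)" if "v \<in> R" for v
      using oddR[OF that] odd_\<sigma>[of v] unfolding ZR[OF that] even_mult_iff of_nat_add[symmetric] by simp
    show "0 < \<sigma> v * (\<Sum>w\<in>V. z v w)" if v: "v \<in> R" for v
    proof -
      have "int (card {w\<in>V. F v w} + of_bool (v \<in> A)) > 0"
        using odd_pos[OF oddR[OF v]] by (simp only: of_nat_0_less_iff)
      then show ?thesis unfolding ZR[OF v] using \<sigma>[of v] by (elim disjE) simp_all
    qed
    show "even (\<Sum>w\<in>V. z u w)" if "u \<in> V - R" for u using that evU evr unfolding VR by auto
    show "(\<Sum>w\<in>V. z u w) \<noteq> (\<Sum>w\<in>V. z v w)" if uv: "u \<in> V - R" "v \<in> V - R" "E u v" for u v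
    proof -
      consider "u = r" "v \<in> U" | "v = r" "u \<in> U" using uv U_indep[of u v] E_irr unfolding VR by auto
      then show ?thesis
      proof cases
        case 1
        then show ?thesis using neq[of v] uv ZU[of v] Zr by auto
      next
        case 2
        then show ?thesis using neq[of u] E_sym[OF uv(3)] ZU[of u] Zr by auto
      qed
    qed
  qed (use R_V sg in auto)
qed

lemma join_xor:
  assumes "join T F" "join T' F'" "\<And>v. v \<in> V - {r} \<Longrightarrow> T'' v \<longleftrightarrow> T v \<noteq> T' v"
  shows "join T'' (\<lambda>u w. F u w \<noteq> F' u w)"
proof -
  have eq: "F u w = F w u" "F' u w = F' w u" for u w
    using assms(1,2) unfolding join_def by blast+
  show ?thesis unfolding join_def
  proof (intro conjI allI impI ballI)
    show "B' u w" if "F u w \<noteq> F' u w" for u w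
      using assms(1,2) that unfolding join_def by blast
    show "F w u \<noteq> F' w u" if "F u w \<noteq> F' u w" for u w
      using that by (simp add: eq[of w u])
    show "odd (card {w\<in>V. F v w \<noteq> F' v w}) \<longleftrightarrow> T'' v" if "v \<in> V - {r}" for v
    proof -
      have "odd (card {w\<in>V. F v w}) \<longleftrightarrow> T v" "odd (card {w\<in>V. F' v w}) \<longleftrightarrow> T' v"
        using assms(1,2) that unfolding join_def by blast+
      then show ?thesis using odd_card_xor[OF fin, of "F v" "F' v"] assms(3)[OF that] by simp
    qed
  qed
qed

text \<open>Choosing a subgraph \<open>P\<close> that still connects everything but \<open>r\<close>
  to the root keeps unwanted edges out of the join.\<close>

lemma join_restrict:
  assumes P: "\<And>u w. P u w \<Longrightarrow> B' u w" "\<And>u w. P u w \<Longrightarrow> P w u"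
    and con: "\<And>v. v \<in> V - {r} \<Longrightarrow> P\<^sup>*\<^sup>* v \<rho>" and T: "even (card {v\<in>V - {r}. T v})"
  shows "\<exists>F. join T F \<and> (\<forall>u w. F u w \<longrightarrow> P u w)"
proof -
  have PV: "P u w \<Longrightarrow> u \<in> V - {r}" for u w using P(1) B_V by (auto simp: B'_def)
  have P_irr: "\<not> P u u" for u using P(1)[of u u] by (auto simp: B'_def B_def)
  have \<rho>: "\<rho> \<in> V - {r}" using \<rho>_V \<rho>_U r by auto
  have "\<exists>F. (\<forall>u w. F u w \<longrightarrow> P u w) \<and> (\<forall>u w. F u w \<longrightarrow> F w u) \<and>
           (\<forall>v\<in>V - {r}. odd (card {w\<in>V - {r}. F v w}) \<longleftrightarrow> v \<in> {v\<in>V - {r}. T v})"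
    by (rule tjoin) (rule finite_Diff fin P_irr \<rho> T Collect_restrict | erule P(2) PV con)+
  then obtain F where F: "\<forall>u w. F u w \<longrightarrow> P u w" "\<forall>u w. F u w \<longrightarrow> F w u"
      "\<forall>v\<in>V - {r}. odd (card {w\<in>V - {r}. F v w}) \<longleftrightarrow> v \<in> {v\<in>V - {r}. T v}"
    by (elim exE conjE)
  have "\<not> F v r" for v using F(1,2) PV[of r v] by blast
  then have "{w\<in>V. F v w} = {w\<in>V - {r}. F v w}" for v by blast
  then have "\<forall>v\<in>V - {r}. odd (card {w\<in>V. F v w}) \<longleftrightarrow> T v" using F(3) by simp
  then have "join T F" unfolding join_def using F(1,2) P(1) by blast
  then show ?thesis using F(1) by blast
qed

lemma join_path:
  assumes P: "\<And>u w. P u w \<Longrightarrow> B' u w" "\<And>u w. P u w \<Longrightarrow> P w u"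
    and con: "P\<^sup>*\<^sup>* a b" "a \<noteq> b"
  shows "\<exists>F. join (\<lambda>v. v = a \<or> v = b) F \<and> (\<forall>u w. F u w \<longrightarrow> P u w)"
proof -
  have PV: "P u w \<Longrightarrow> u \<in> V" for u w using P(1) B_V by (auto simp: B'_def)
  have P_irr: "\<not> P u u" for u using P(1)[of u u] by (auto simp: B'_def B_def)
  have "\<exists>F. (\<forall>u w. F u w \<longrightarrow> P u w) \<and> (\<forall>u w. F u w \<longrightarrow> F w u) \<and>
           (\<forall>v\<in>V. odd (card {w\<in>V. F v w}) \<longleftrightarrow> v = a \<or> v = b)"
    by (rule path_tjoin) (rule fin P_irr con | erule P(2) PV)+
  then obtain F where F: "\<forall>u w. F u w \<longrightarrow> P u w" "\<forall>u w. F u w \<longrightarrow> F w u"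
      "\<forall>v\<in>V. odd (card {w\<in>V. F v w}) \<longleftrightarrow> v = a \<or> v = b"
    by blast
  have "join (\<lambda>v. v = a \<or> v = b) F"
    unfolding join_def using F P(1) by blast
  then show ?thesis using F(1) by blast
qed

end

subsection \<open>The exceptional vertex\<close>

context independent_split
begin

text \<open>The distance from \<open>v\<close> to the root in \<open>B\<close>.\<close>

definition \<delta> :: "'a \<Rightarrow> nat" where
  "\<delta> v = (LEAST n. (B ^^ n) v \<rho>)"

lemma \<delta>_relpow: "v \<in> V \<Longrightarrow> (B ^^ \<delta> v) v \<rho>"
  unfolding \<delta>_def using rtranclp_imp_relpowp[OF B_reach] by (metis LeastI)

lemma \<delta>_root: "\<delta> \<rho> = 0"
  unfolding \<delta>_def by (rule Least_equality) auto

lemma \<delta>_le_Suc: "B v w \<Longrightarrow> \<delta> v \<le> Suc (\<delta> w)"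
proof -
  assume vw: "B v w"
  have "(B ^^ Suc (\<delta> w)) v \<rho>" using relpowp_Suc_I2[OF vw \<delta>_relpow[OF B_V2[OF vw]]] .
  then show ?thesis unfolding \<delta>_def[of v] by (rule Least_le)
qed

lemma \<delta>_parent:
  assumes "v \<in> V" "v \<noteq> \<rho>"
  shows "\<exists>w. B v w \<and> \<delta> w < \<delta> v"
proof -
  have *: "(B ^^ \<delta> v) v \<rho>" using \<delta>_relpow[OF assms(1)] .
  then have "\<delta> v \<noteq> 0" using assms(2) by (auto intro: ccontr)
  then obtain n where n: "\<delta> v = Suc n" by (cases "\<delta> v") auto
  then obtain w where w: "B v w" "(B ^^ n) w \<rho>" using * relpowp_Suc_D2 by (metis (no_types))
  then have "\<delta> w \<le> n" unfolding \<delta>_def[of w] by (intro Least_le)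
  then show ?thesis using w n by auto
qed

text \<open>Going from each vertex to one nearer to the root never meets \<open>Q\<close>, since no
  vertex of \<open>Q\<close> is nearer than the start.\<close>

lemma descend:
  assumes "\<rho> \<notin> Q" "x \<in> V" "x \<notin> Q" "\<And>q. q \<in> Q \<Longrightarrow> \<delta> x \<le> \<delta> q"
  shows "(\<lambda>u w. B u w \<and> u \<notin> Q \<and> w \<notin> Q)\<^sup>*\<^sup>* x \<rho>"
  using assms(2-)
proof (induction "\<delta> x" arbitrary: x rule: less_induct)
  case less
  show ?case
  proof (cases "x = \<rho>")
    case False
    then obtain w where w: "B x w" "\<delta> w < \<delta> x" using \<delta>_parent less.prems by blast
    have Q: "w \<notin> Q" "\<And>q. q \<in> Q \<Longrightarrow> \<delta> w \<le> \<delta> q" using w less.prems(3) by fastforce+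
    then have "(\<lambda>u w. B u w \<and> u \<notin> Q \<and> w \<notin> Q)\<^sup>*\<^sup>* w \<rho>"
      using less.hyps[OF w(2)] B_V2[OF w(1)] by blast
    then show ?thesis using w Q less.prems by (intro converse_rtranclp_into_rtranclp[of _ x w]) auto
  qed simp
qed

lemma h_le: "v \<in> V \<Longrightarrow> h v \<le> d"
  unfolding h_def deg[of v, symmetric] using fin U_V by (intro card_mono) auto

lemma h_less: "v \<in> V \<Longrightarrow> E v w \<Longrightarrow> w \<notin> U \<Longrightarrow> h v < d"
  unfolding h_def deg[of v, symmetric] using fin U_V E_V2 by (intro psubset_card_mono) auto

lemma h_less_iff: "v \<in> V \<Longrightarrow> h v < d \<longleftrightarrow> (\<exists>w. E v w \<and> w \<notin> U)"
proof
  assume v: "v \<in> V" "h v < d"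
  show "\<exists>w. E v w \<and> w \<notin> U"
  proof (rule ccontr)
    assume "\<not> ?thesis"
    then have "{u\<in>U. E v u} = {w\<in>V. E v w}" using U_V by auto
    then show False using v deg[of v] by (simp add: h_def)
  qed
qed (use h_less in blast)

end

text \<open>For a vertex \<open>v\<close>, \<open>h v < d\<close> says that \<open>v\<close> has a
  neighbour outside \<open>U\<close>; \<open>r\<close> is a farthest such vertex outside
  \<open>U\<close>.\<close>

locale extremal_exceptional = exceptional_vertex +
  assumes hr: "h r < d" and far: "v \<in> V \<Longrightarrow> v \<notin> U \<Longrightarrow> h v < d \<Longrightarrow> \<delta> v \<le> \<delta> r"
begin

lemma \<rho>r: "\<rho> \<noteq> r"
  using r \<rho>_U by blast

text \<open>By the choice of \<open>r\<close>, every vertex outside \<open>U\<close> that is cut off by \<open>r\<close> has all its \<open>d\<close> neighbours in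
  \<open>U\<close>. Counting the edges of \<open>B\<close> in the part \<open>K\<close> that is cut off from both sides shows that \<open>d\<close>
  divides the number of edges between \<open>K\<close> and \<open>r\<close>, which is less than \<open>d\<close>.\<close>

lemma B'_reach:
  assumes "v \<in> V - {r}"
  shows "B'\<^sup>*\<^sup>* v \<rho>"
proof (rule ccontr)
  assume not: "\<not> B'\<^sup>*\<^sup>* v \<rho>"
  define K where "K = {x\<in>V - {r}. \<not> B'\<^sup>*\<^sup>* x \<rho>}"
  have K_closed: "w \<in> K" if "u \<in> K" "B' u w" for u w
  proof -
    have "\<not> B'\<^sup>*\<^sup>* w \<rho>" using that converse_rtranclp_into_rtranclp[of B' u w \<rho>] by (auto simp: K_def)
    then show ?thesis using that B_V2 by (auto simp: K_def B'_def)
  qed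
  have hK: "h z = d" if z: "z \<in> K" "z \<notin> U" for z
  proof (rule ccontr)
    assume "h z \<noteq> d"
    then have "h z < d" using h_le[of z] z by (auto simp: K_def)
    then have "\<delta> z \<le> \<delta> r" using far z by (auto simp: K_def)
    then have "(\<lambda>u w. B u w \<and> u \<notin> {r} \<and> w \<notin> {r})\<^sup>*\<^sup>* z \<rho>"
      using \<rho>r z by (intro descend) (auto simp: K_def)
    then have "B'\<^sup>*\<^sup>* z \<rho>" by (simp add: B'_def[abs_def])
    then show False using z by (simp add: K_def)
  qed
  define K1 where "K1 = K \<inter> U"
  define K2 where "K2 = K - U"
  have finK: "finite K1" "finite K2" using fin by (auto simp: K_def K1_def K2_def)
  have c2: "card {u\<in>K1. E z u} = d" if "z \<in> K2" for z
  proof -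
    have "{u\<in>K1. E z u} = {u\<in>U. E z u}"
      using that K_closed[of z] r by (auto simp: K1_def K2_def K_def B'_def B_def)
    then show ?thesis using hK[of z] that by (simp add: h_def K2_def)
  qed
  \<comment> \<open>The cardinality of the intersection is 1 or 0 according to whether
    \<open>u\<close> is adjacent to \<open>r\<close>, the only neighbour of \<open>u\<close> that
    can lie outside \<open>K\<close>.\<close>
  have c1: "card {z\<in>K2. E u z} + card ({u} \<inter> {u\<in>K1. E r u}) = d" if u: "u \<in> K1" for u
  proof -
    have uV: "u \<in> V" "u \<in> U" "u \<in> K" using u by (auto simp: K1_def K_def)
    have "{w\<in>V. E u w} = {z\<in>K2. E u z} \<union> ({w. w = r \<and> E u r})"
    proof -
      have "w \<in> K2" if "E u w" "w \<noteq> r" for w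
        using K_closed[of u w] that uV r U_indep[of u w] by (auto simp: K2_def B'_def B_def)
      then show ?thesis using r by (auto simp: K2_def K_def)
    qed
    then have "d = card ({z\<in>K2. E u z} \<union> {w. w = r \<and> E u r})" using deg[OF uV(1)] by simp
    also have "\<dots> = card {z\<in>K2. E u z} + card {w. w = r \<and> E u r}"
    proof (rule card_Un_disjoint)
      show "finite {z\<in>K2. E u z}" using finK(2) by simp
      show "{z\<in>K2. E u z} \<inter> {w. w = r \<and> E u r} = {}" by (auto simp: K2_def K_def)
    qed simp
    also have "card {w. w = r \<and> E u r} = card ({u} \<inter> {u\<in>K1. E r u})"
      using u E_sym by (cases "E u r") auto
    finally show ?thesis by simp
  qed
  have "d * card K1 = (\<Sum>u\<in>K1. card {z\<in>K2. E u z} + card ({u} \<inter> {u\<in>K1. E r u}))"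
    using c1 by simp
  also have "\<dots> = (\<Sum>u\<in>K1. card {z\<in>K2. E u z}) + (\<Sum>u\<in>K1. card ({u} \<inter> {u\<in>K1. E r u}))"
    by (rule sum.distrib)
  also have "(\<Sum>u\<in>K1. card {z\<in>K2. E u z}) = (\<Sum>z\<in>K2. card {u\<in>K1. E z u})"
    using finK E_sym by (intro double_count) auto
  also have "\<dots> = d * card K2" using c2 by simp
  also have "(\<Sum>u\<in>K1. card ({u} \<inter> {u\<in>K1. E r u})) = (\<Sum>u\<in>K1. if E r u then 1 else 0)"
    by (intro sum.cong refl) auto
  also have "\<dots> = card {u\<in>K1. E r u}" using finK by (simp add: sum.inter_filter[symmetric])
  finally have "d dvd card {u\<in>K1. E r u}" by (metis dvd_add_right_iff dvd_triv_left)
  moreover have "card {u\<in>K1. E r u} \<le> h r"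
    unfolding h_def using fin_U by (intro card_mono) (auto simp: K1_def)
  ultimately have "card {u\<in>K1. E r u} = 0"
    using hr nat_dvd_not_less[of "card {u\<in>K1. E r u}" d] by linarith
  then have no: "\<not> E r u" if "u \<in> K1" for u using finK that by auto
  have "v \<in> K" "\<rho> \<notin> K" using not assms by (auto simp: K_def)
  moreover have "B\<^sup>*\<^sup>* v \<rho>" using assms B_reach by blast
  \<comment> \<open>A path to the root must leave \<open>K\<close>, and can only do so by a step
    from \<open>K1\<close> to \<open>r\<close>.\<close>
  ultimately obtain y x where yx: "y \<in> K" "x \<notin> K" "B y x" using rtranclp_leaves by metis
  then have "x = r" using K_closed[of y x] by (auto simp: B'_def K_def)
  then show False using yx no[of y] r E_sym by (auto simp: K1_def B_def)
qed

lemma join_exists: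
  assumes "A \<subseteq> V - {r}" "even (card A)"
  shows "\<exists>F. join (\<lambda>v. (v \<in> R) \<noteq> (v \<in> A)) F"
proof -
  have "{v\<in>V-{r}. v \<in> R} = R" "{v\<in>V-{r}. v \<in> A} = A" using assms R_V by (auto simp: R_def)
  then have ev: "even (card {v\<in>V-{r}. (v \<in> R) \<noteq> (v \<in> A)})"
    using odd_card_xor[of "V - {r}" "\<lambda>v. v \<in> R" "\<lambda>v. v \<in> A"] fin assms evenR by simp
  have "\<exists>F. join (\<lambda>v. (v \<in> R) \<noteq> (v \<in> A)) F \<and> (\<forall>u w. F u w \<longrightarrow> B' u w)"
    by (rule join_restrict) (assumption | erule B'_sym B'_reach | rule ev)+
  then show ?thesis by blast
qed

text \<open>All edges from \<open>r\<close> to \<open>U\<close> are weighted, plus one edge to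
  \<open>w\<close> outside \<open>U\<close> if their number is odd. The join depends on
  \<open>A\<close> but not on the signs, so what remains is that, for each neighbour in
  \<open>I\<close>, the sum of the other signs avoids a fixed number.\<close>

lemma distinguishing_if_h_ge_2:
  assumes "h r \<ge> 2"
  shows "\<exists>x. distinguishing x"
proof -
  define I where "I = {u\<in>U. E r u}"
  have I: "finite I" "card I \<ge> 2" "I \<subseteq> U" using assms fin_U by (auto simp: I_def h_def)
  obtain w where w: "E r w" "w \<notin> U" using h_less_iff[OF r(1)] hr by blast
  define A where "A = (if even (card I) then I else insert w I)"
  have A: "a \<in> A \<Longrightarrow> E r a" for a using w by (auto simp: A_def I_def split: if_splits)
  have "w \<notin> I" using w by (simp add: I_def)
  then have evA: "even (card A)" using I by (simp add: A_def)
  have "A \<subseteq> V - {r}" using A E_V2 E_irr by blast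
  then obtain F where F: "join (\<lambda>v. (v \<in> R) \<noteq> (v \<in> A)) F" using join_exists evA by blast
  obtain s where s: "\<And>i. s i = 1 \<or> s i = (-1::int)"
     "\<And>i. i \<in> I \<Longrightarrow> sum s I - s i \<noteq> \<gamma> F i - sum \<sigma> (A - U)"
    using sign_choice[OF I(1,2), of "\<lambda>i. \<gamma> F i - sum \<sigma> (A - U)"] by blast
  have AU: "A \<inter> U = I" using w by (auto simp: A_def I_def)
  show ?thesis
  proof (rule distinguishing_from_join[OF A evA F s(1)])
    fix u assume "u \<in> U" "E r u"
    then have "u \<in> I" by (simp add: I_def)
    moreover have "u \<in> A" using AU calculation by blast
    ultimately show "sum s (A \<inter> U) + sum \<sigma> (A - U) \<noteq> \<gamma> F u + (if u \<in> A then s u else 0)"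
      using s(2)[of u] unfolding AU by auto
  qed
qed

lemma \<gamma>_cong:
  assumes "\<And>w. F u w = G u w"
  shows "\<gamma> F u = \<gamma> G u"
  unfolding \<gamma>_def using assms by simp

text \<open>Only \<open>r\<close> and its unique neighbour \<open>u\<close> in \<open>U\<close> can collide. If some neighbour \<open>v \<notin> U\<close> of \<open>r\<close> is cut off
  by \<open>u\<close>, then \<open>r\<close>, \<open>u\<close>, \<open>v\<close> form a triangle and parity can be moved between the edges \<open>uv\<close> and \<open>rv\<close>.
  Otherwise two neighbours of \<open>r\<close> outside \<open>U\<close> are joined by a path that avoids \<open>u\<close>, and switching along it
  changes the value of \<open>r\<close> relative to that of \<open>u\<close>.\<close>

lemma distinguishing_if_h_eq_1:
  assumes "h r = 1" "d \<ge> 3"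
  shows "\<exists>x. distinguishing x"
proof -
  obtain u where u: "{u\<in>U. E r u} = {u}" using assms by (auto simp: h_def card_1_singleton_iff)
  then have uU: "u \<in> U" "E r u" "E u r" "u \<noteq> r" and only: "\<And>t. t \<in> U \<Longrightarrow> E r t \<Longrightarrow> t = u"
    using E_sym r by blast+
  have uV: "u \<in> V" using uU U_V by blast
  define N where "N = {v\<in>V. E r v} - {u}"
  have N: "v \<in> V" "v \<noteq> r" "v \<notin> U" "v \<in> R" "v \<noteq> u" "E r v" if "v \<in> N" for v
    using that only E_irr by (auto simp: N_def R_def)
  have "card N = d - 1" using deg[OF r(1)] uU uV fin by (simp add: N_def)
  \<comment> \<open>Three choices of weighted edges at \<open>r\<close>. Without any,
    \<open>r\<close> has value 0. With edges to \<open>u\<close> and \<open>v\<close>, the edge to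
    \<open>u\<close> adds 1 to both values, which leaves \<open>\<sigma> v\<close> against
    \<open>\<gamma> F u\<close>. With edges to \<open>v\<close> and \<open>w\<close> of equal sign,
    \<open>r\<close> has value \<open>2 * \<sigma> v\<close>, which is not 0.\<close>
  have none: ?thesis if "join (\<lambda>v. v \<in> R) F" "\<gamma> F u \<noteq> 0" for F
    using that(2) only by (intro distinguishing_from_join[of "{}" F "\<lambda>_. 1"]) (use that in auto)
  have one: ?thesis if "v \<in> N" "join (\<lambda>t. (t \<in> R) \<noteq> (t = u \<or> t = v)) F" "\<gamma> F u \<noteq> \<sigma> v" for v F
  proof (rule distinguishing_from_join[of "{u, v}" F "\<lambda>_. 1"])
    have "{u, v} \<inter> U = {u}" "{u, v} - U = {v}" using uU N[OF that(1)] by auto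
    then show "sum (\<lambda>_. 1) ({u, v} \<inter> U) + sum \<sigma> ({u, v} - U)
        \<noteq> \<gamma> F t + (if t \<in> {u, v} then 1 else 0)" if "t \<in> U" "E r t" for t
      using only[OF that] \<open>\<gamma> F u \<noteq> \<sigma> v\<close> by simp
  qed (use that uU N[OF that(1)] in auto)
  have two: ?thesis if vw: "v \<in> N" "w \<in> N" "v \<noteq> w" "\<sigma> v = \<sigma> w"
      and F: "join (\<lambda>t. (t \<in> R) \<noteq> (t = v \<or> t = w)) F" "\<gamma> F u = 0" for v w F
  proof (rule distinguishing_from_join[of "{v, w}" F "\<lambda>_. 1"])
    have vw': "{v, w} \<inter> U = {}" "{v, w} - U = {v, w}" "u \<noteq> v" "u \<noteq> w"
      using N[OF vw(1)] N[OF vw(2)] by auto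
    show "sum (\<lambda>_. 1) ({v, w} \<inter> U) + sum \<sigma> ({v, w} - U)
        \<noteq> \<gamma> F t + (if t \<in> {v, w} then 1 else 0)" if "t \<in> U" "E r t" for t
      using only[OF that] vw vw' F(2) \<sigma>[of w] by (elim disjE) simp_all
    show "E r a" if "a \<in> {v, w}" for a using that N vw by blast
    show "even (card {v, w})" using vw by simp
    show "join (\<lambda>t. (t \<in> R) \<noteq> (t \<in> {v, w})) F" using F(1) by simp
  qed simp
  have J1: "\<exists>F. join (\<lambda>t. (t \<in> R) \<noteq> (t = u \<or> t = v)) F" if "v \<in> N" for v
    using join_exists[of "{u, v}"] uU uV N[OF that] by auto
  have J0: "\<exists>F. join (\<lambda>v. v \<in> R) F"
    using join_exists[of "{}"] by auto
  define Q where "Q a b \<longleftrightarrow> B a b \<and> a \<notin> {u, r} \<and> b \<notin> {u, r}" for a b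
  have Q_sym: "Q a b \<Longrightarrow> Q b a" for a b using B_sym by (auto simp: Q_def)
  have QB: "Q a b \<Longrightarrow> B' a b" for a b by (auto simp: Q_def B'_def)
  have u_r: "\<delta> r \<le> Suc (\<delta> u)" using uU r by (intro \<delta>_le_Suc) (auto simp: B_def)
  \<comment> \<open>Let \<open>w\<close> be nearer to the root than \<open>z\<close> and adjacent to
    it in \<open>B\<close>. Then \<open>w\<close> is nearer than \<open>r\<close>, hence no farther
    than \<open>u\<close>. If \<open>u\<close> is the root, this forces \<open>w = u\<close>;
    otherwise, if \<open>w\<close> were not \<open>u\<close>, descending from \<open>w\<close> would
    link \<open>z\<close> to the root avoiding \<open>u\<close> and \<open>r\<close>.\<close>
  have near: "E z u" if z: "z \<in> V" "z \<notin> U" "z \<noteq> r" "h z < d" "\<not> (u \<noteq> \<rho> \<and> Q\<^sup>*\<^sup>* z \<rho>)" for z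
  proof -
    have "z \<noteq> \<rho>" using z \<rho>_U by blast
    then obtain w where w: "B z w" "\<delta> w < \<delta> z" using \<delta>_parent z by blast
    have wr: "w \<noteq> r" "\<delta> w \<le> \<delta> u" using w far[of z] z u_r by auto
    have "w = u"
    proof (rule ccontr)
      assume wu: "w \<noteq> u"
      show False
      proof (cases "u = \<rho>")
        case True
        then have "\<delta> w = 0" using wr \<delta>_root by simp
        then show False using \<delta>_parent[of w] B_V2[OF w(1)] wu True by auto
      next
        case False
        have "\<delta> w \<le> \<delta> r" using w far[of z] z by auto
        then have "(\<lambda>a b. B a b \<and> a \<notin> {u, r} \<and> b \<notin> {u, r})\<^sup>*\<^sup>* w \<rho>"
          using False \<rho>r wr wu B_V2[OF w(1)] by (intro descend) auto
        then have "Q\<^sup>*\<^sup>* w \<rho>" unfolding Q_def[abs_def] .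
        moreover have "Q z w" using w wr wu z uU by (auto simp: Q_def)
        ultimately show False using z False by (auto intro: converse_rtranclp_into_rtranclp)
      qed
    qed
    then show ?thesis using w by (simp add: B_def)
  qed
  show ?thesis
  proof (cases "\<exists>v\<in>N. \<not> (u \<noteq> \<rho> \<and> Q\<^sup>*\<^sup>* v \<rho>)")
    case True
    then obtain v where v: "v \<in> N" "\<not> (u \<noteq> \<rho> \<and> Q\<^sup>*\<^sup>* v \<rho>)" by blast
    note Nv = N[OF v(1)]
    have hv: "h v < d" using h_less[OF Nv(1) E_sym[OF Nv(6)]] r by simp
    have vu: "E v u" using near[of v] v(2) Nv hv by blast
    have B'vu: "B' v u" "B' u v" using vu E_sym Nv uU by (auto simp: B'_def B_def)
    \<comment> \<open>The single edge \<open>u v\<close>; toggling it exchanges joins for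
      \<open>A = {}\<close> and for \<open>A = {u, v}\<close>.\<close>
    define D where "D a b \<longleftrightarrow> a = u \<and> b = v \<or> a = v \<and> b = u" for a b
    define P where "P a b \<longleftrightarrow> B' a b \<and> \<not> D a b" for a b
    have P_sym: "P a b \<Longrightarrow> P b a" for a b using B'_sym by (auto simp: P_def D_def)
    have joinD: "join (\<lambda>t. t = u \<or> t = v) D"
    proof -
      have "card {w\<in>V. D t w} = (if t = u \<or> t = v then 1 else 0)" for t
      proof -
        have "{w\<in>V. D t w} = (if t = u then {v} else if t = v then {u} else {})"
          using Nv uV by (auto simp: D_def)
        then show ?thesis by auto
      qed
      then show ?thesis unfolding join_def using B'vu by (auto simp: D_def)
    qed
    \<comment> \<open>If \<open>P\<close> still links \<open>v\<close> to \<open>u\<close>, a join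
      can be found within \<open>P\<close>. Otherwise counting edges in the component
      \<open>K\<close> of \<open>v\<close> shows that \<open>u\<close> is the only neighbour of
      \<open>v\<close> in \<open>U\<close>; a join for \<open>A = {}\<close> then has to use
      \<open>u v\<close>, and toggling removes it.\<close>
    have "\<exists>F. join (\<lambda>t. (t \<in> R) \<noteq> (t = u \<or> t = v)) F \<and> \<not> F u v"
    proof (cases "P\<^sup>*\<^sup>* v u")
      case True
      have uv: "P\<^sup>*\<^sup>* u v"
        using True by (induction rule: rtranclp_induct) (auto intro: P_sym converse_rtranclp_into_rtranclp)
      have step: "P\<^sup>*\<^sup>* a b" if "B' a b" for a b
        using that True uv by (cases "D a b") (auto simp: P_def D_def)
      have conP: "P\<^sup>*\<^sup>* a \<rho>" if "a \<in> V - {r}" for a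
        using B'_reach[OF that]
        by (induction rule: converse_rtranclp_induct) (auto intro: rtranclp_trans step)
      have A: "{u, v} \<subseteq> V - {r}" "even (card {u, v})" using uU uV Nv by auto
      have "{t\<in>V-{r}. t \<in> R} = R" "{t\<in>V-{r}. t = u \<or> t = v} = {u, v}" using A R_V by (auto simp: R_def)
      then have ev: "even (card {t\<in>V-{r}. (t \<in> R) \<noteq> (t = u \<or> t = v)})"
        using odd_card_xor[of "V - {r}" "\<lambda>t. t \<in> R" "\<lambda>t. t = u \<or> t = v"] fin A evenR by simp
      have "\<exists>F. join (\<lambda>t. (t \<in> R) \<noteq> (t = u \<or> t = v)) F \<and> (\<forall>a b. F a b \<longrightarrow> P a b)"
      proof (rule join_restrict)
        show "B' a b" if "P a b" for a b using that by (simp add: P_def)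
        show "P b a" if "P a b" for a b using P_sym[OF that] .
        show "P\<^sup>*\<^sup>* a \<rho>" if "a \<in> V - {r}" for a using conP[OF that] .
      qed (rule ev)
      then show ?thesis by (auto simp: P_def D_def)
    next
      case False
      define K where "K = {x. P\<^sup>*\<^sup>* v x}"
      have vK: "v \<in> K" and uK: "u \<notin> K" using False by (auto simp: K_def)
      have K_closed: "b \<in> K" if "a \<in> K" "P a b" for a b
        using that by (auto simp: K_def intro: rtranclp.rtrancl_into_rtrancl)
      have KV: "K \<subseteq> V - {r}"
      proof
        fix x assume "x \<in> K"
        then have "P\<^sup>*\<^sup>* v x" by (simp add: K_def)
        then show "x \<in> V - {r}"
          by (induction rule: rtranclp_induct) (use Nv B_V2 in \<open>auto simp: P_def B'_def\<close>)
      qed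
      have KQ: "Q\<^sup>*\<^sup>* v x" if "x \<in> K" for x
      proof -
        have "P\<^sup>*\<^sup>* v x" using that by (simp add: K_def)
        then show ?thesis
        proof (induction rule: rtranclp_induct)
          case (step y z)
          then have "y \<in> K" "z \<in> K" by (auto simp: K_def intro: rtranclp.rtrancl_into_rtrancl)
          then have "Q y z" using step uK KV by (auto simp: Q_def P_def B'_def)
          then show ?case using step by (auto intro: rtranclp.rtrancl_into_rtrancl)
        qed simp
      qed
      have hz: "h z = d" if z: "z \<in> K" "z \<notin> U" "z \<noteq> v" for z
      proof (rule ccontr)
        assume "h z \<noteq> d"
        then have hz: "h z < d" using h_le[of z] z KV by fastforce
        have "\<not> (u \<noteq> \<rho> \<and> Q\<^sup>*\<^sup>* z \<rho>)" using KQ[OF z(1)] v(2) by (metis rtranclp_trans)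
        then have "E z u" using near[of z] hz z KV by blast
        then have "P z u" using z KV uU Nv by (auto simp: P_def D_def B'_def B_def)
        then show False using K_closed z uK by blast
      qed
      define K1 where "K1 = K \<inter> U"
      define K2 where "K2 = K - U"
      have finK: "finite K1" "finite K2" using KV fin finite_subset[of K V] by (auto simp: K1_def K2_def)
      have c2: "card {t\<in>K1. E z t} = d" if z: "z \<in> K2 - {v}" for z
      proof -
        have "{t\<in>K1. E z t} = {t\<in>U. E z t}"
        proof -
          have "t \<in> K" if "t \<in> U" "E z t" for t
          proof -
            have "P z t" using that z KV r Nv by (auto simp: P_def D_def B'_def B_def K2_def)
            then show ?thesis using K_closed z by (auto simp: K2_def)
          qed
          then show ?thesis by (auto simp: K1_def)
        qed
        then show ?thesis using hz[of z] z by (auto simp: h_def K2_def)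
      qed
      \<comment> \<open>Only \<open>u\<close> among the neighbours of \<open>v\<close> in
        \<open>U\<close> lies outside \<open>K\<close>. All other vertices of \<open>K2\<close> have
        \<open>d\<close> neighbours in \<open>K1\<close>, so double counting makes \<open>d\<close>
        divide \<open>h v - 1\<close>, which is therefore 0.\<close>
      have cv: "card {t\<in>K1. E v t} + 1 = h v"
      proof -
        have "t \<in> K" if "t \<in> U" "E v t" "t \<noteq> u" for t
        proof -
          have "P v t" using that Nv r by (auto simp: P_def D_def B'_def B_def)
          then show ?thesis using K_closed vK by blast
        qed
        then have "{t\<in>U. E v t} = insert u {t\<in>K1. E v t}" using uU vu by (auto simp: K1_def)
        moreover have "u \<notin> {t\<in>K1. E v t}" using uK by (simp add: K1_def)
        ultimately show ?thesis using finK by (simp add: h_def)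
      qed
      have c1: "card {z\<in>K2. E t z} = d" if t: "t \<in> K1" for t
      proof -
        have tK: "t \<in> U" "t \<in> K" "t \<noteq> u" "t \<in> V" using t uK KV by (auto simp: K1_def)
        have "z \<in> K2" if "E t z" for z
        proof -
          have "z \<noteq> r" using that only[of t] E_sym tK by blast
          moreover have "z \<notin> U" using that U_indep tK by blast
          ultimately have "P t z" using that tK KV Nv by (auto simp: P_def D_def B'_def B_def)
          then show ?thesis using K_closed tK \<open>z \<notin> U\<close> by (auto simp: K2_def)
        qed
        then have "{z\<in>K2. E t z} = {z\<in>V. E t z}" using KV by (auto simp: K2_def)
        then show ?thesis using deg[OF tK(4)] by simp
      qed
      have "d * card K1 = (\<Sum>t\<in>K1. card {z\<in>K2. E t z})" using c1 by simp
      also have "\<dots> = (\<Sum>z\<in>K2. card {t\<in>K1. E z t})" using finK E_sym by (intro double_count) auto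
      also have "\<dots> = card {t\<in>K1. E v t} + (\<Sum>z\<in>K2 - {v}. card {t\<in>K1. E z t})"
        using finK vK Nv by (intro sum.remove) (auto simp: K2_def)
      also have "(\<Sum>z\<in>K2 - {v}. card {t\<in>K1. E z t}) = d * card (K2 - {v})" using c2 by simp
      finally have "d dvd card {t\<in>K1. E v t}" by (metis dvd_add_left_iff dvd_triv_left)
      moreover have "card {t\<in>K1. E v t} < d" using cv hv by simp
      ultimately have "card {t\<in>K1. E v t} = 0"
        using nat_dvd_not_less[of "card {t\<in>K1. E v t}" d] by linarith
      then have "h v = 1" using cv by simp
      then obtain y where "{t\<in>U. E v t} = {y}" by (auto simp: h_def card_1_singleton_iff)
      moreover have "u \<in> {t\<in>U. E v t}" using uU vu by simp
      ultimately have hv1: "{t\<in>U. E v t} = {u}" by auto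
      obtain F where F: "join (\<lambda>v. v \<in> R) F" using J0 by blast
      have FB: "F a b \<Longrightarrow> B' a b" "F a b \<Longrightarrow> F b a" for a b using F unfolding join_def by blast+
      have "odd (card {w\<in>V. F v w})" using F Nv unfolding join_def by blast
      then have "{w\<in>V. F v w} \<noteq> {}" by (metis card.empty even_zero)
      then obtain w where w: "F v w" by blast
      then have "w = u" using FB(1)[OF w] hv1 Nv by (auto simp: B'_def B_def)
      then have "F u v" using w FB(2) by blast
      moreover have "join (\<lambda>t. (t \<in> R) \<noteq> (t = u \<or> t = v)) (\<lambda>a b. F a b \<noteq> D a b)"
        by (rule join_xor[OF F joinD]) simp
      ultimately show ?thesis by (auto simp: D_def)
    qed
    then obtain F where F: "join (\<lambda>t. (t \<in> R) \<noteq> (t = u \<or> t = v)) F" "\<not> F u v" by blast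
    show ?thesis
    proof (cases "\<gamma> F u = \<sigma> v")
      case True
      \<comment> \<open>Adding \<open>u v\<close> to the join and dropping both edges at
        \<open>r\<close> gives \<open>u\<close> the value \<open>2 * \<sigma> v\<close> and
        \<open>r\<close> the value 0.\<close>
      have "join (\<lambda>t. t \<in> R) (\<lambda>a b. F a b \<noteq> D a b)"
        by (rule join_xor[OF F(1) joinD]) blast
      moreover have "\<gamma> (\<lambda>a b. F a b \<noteq> D a b) u = \<gamma> F u + \<sigma> v"
      proof -
        have "\<gamma> (\<lambda>a b. F a b \<noteq> D a b) u = (\<Sum>w\<in>V. (if F u w then \<sigma> w else 0) + (if w = v then \<sigma> w else 0))"
          unfolding \<gamma>_def using F(2) Nv by (intro sum.cong refl) (auto simp: D_def)
        then show ?thesis using fin Nv by (simp add: sum.distrib \<gamma>_def)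
      qed
      ultimately show ?thesis using none[of "\<lambda>a b. F a b \<noteq> D a b"] True \<sigma>[of v] by auto
    qed (use one[OF v(1) F(1)] in blast)
  next
    case False
    have "\<not> card N \<le> Suc 0" using \<open>card N = d - 1\<close> assms by simp
    moreover have "finite N" using fin by (simp add: N_def)
    ultimately obtain v w where vw: "v \<in> N" "w \<in> N" "v \<noteq> w"
      by (auto simp: card_le_Suc0_iff_eq)
    have reach: "Q\<^sup>*\<^sup>* v \<rho>" "Q\<^sup>*\<^sup>* w \<rho>" using False vw by blast+
    from reach(2) have "Q\<^sup>*\<^sup>* \<rho> w"
      by (induction rule: rtranclp_induct) (auto intro: Q_sym converse_rtranclp_into_rtranclp)
    with reach(1) have "Q\<^sup>*\<^sup>* v w" by (rule rtranclp_trans)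
    then have "\<exists>F. join (\<lambda>t. t = v \<or> t = w) F \<and> (\<forall>a b. F a b \<longrightarrow> Q a b)"
      using vw(3) by (intro join_path) (auto intro: QB Q_sym)
    then obtain H where H: "join (\<lambda>t. t = v \<or> t = w) H" "\<And>a b. H a b \<Longrightarrow> Q a b" by blast
    \<comment> \<open>Toggling \<open>H\<close> changes the parities at \<open>v\<close> and
      \<open>w\<close> but no edge at \<open>u\<close>. For equal signs, \<open>two\<close> applies
      when \<open>none\<close> fails; for different signs, \<open>\<gamma> F u\<close> cannot equal
      both, so \<open>one\<close> applies to \<open>v\<close> or to \<open>w\<close>.\<close>
    have \<gamma>H: "\<gamma> (\<lambda>a b. F a b \<noteq> H a b) u = \<gamma> F u" for F
      using H(2) by (intro \<gamma>_cong) (auto simp: Q_def)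
    show ?thesis
    proof (cases "\<sigma> v = \<sigma> w")
      case True
      obtain F where F: "join (\<lambda>v. v \<in> R) F" using J0 by blast
      have "join (\<lambda>t. (t \<in> R) \<noteq> (t = v \<or> t = w)) (\<lambda>a b. F a b \<noteq> H a b)"
        by (rule join_xor[OF F H(1)]) simp
      note J = this
      show ?thesis
      proof (cases "\<gamma> F u = 0")
        case True
        then show ?thesis using two[OF vw \<open>\<sigma> v = \<sigma> w\<close> J] \<gamma>H[of F] by simp
      qed (rule none[OF F])
    next
      case False
      obtain F where F: "join (\<lambda>t. (t \<in> R) \<noteq> (t = u \<or> t = v)) F" using J1[OF vw(1)] by blast
      have "join (\<lambda>t. (t \<in> R) \<noteq> (t = u \<or> t = w)) (\<lambda>a b. F a b \<noteq> H a b)"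
        using N(5)[OF vw(1)] N(5)[OF vw(2)] vw(3) by (intro join_xor[OF F H(1)]) auto
      note J = this
      show ?thesis
      proof (cases "\<gamma> F u = \<sigma> v")
        case True
        then show ?thesis using one[OF vw(2) J] \<gamma>H[of F] False by simp
      qed (rule one[OF vw(1) F])
    qed
  qed
qed

end

section \<open>Independent complements, cycles, and complements of odd size\<close>

context independent_split
begin

text \<open>Among \<open>n\<close> targets, all 1 or 2, taking \<open>2 * n mod 3\<close> of them to
  be 2 makes the sum divisible by 3. There are enough vertices, since the \<open>d\<close>
  neighbours of the root all lie outside \<open>U\<close> and \<open>d\<close> is at least
  2.\<close>

lemma distinguishing_if_bipartite:
  assumes "d \<ge> 2" and no_edge: "\<And>u w. u \<notin> U \<Longrightarrow> w \<notin> U \<Longrightarrow> \<not> E u w"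
  shows "\<exists>x. distinguishing x"
proof -
  define n where "n = card (V - U)"
  have "{w\<in>V. E \<rho> w} \<subseteq> V - U" using U_indep \<rho>_U by blast
  then have "d \<le> n" using deg[OF \<rho>_V] fin unfolding n_def by (metis card_mono finite_Diff)
  moreover have "2 * n mod 3 < 3" by simp
  ultimately have "2 * n mod 3 \<le> card (V - U)" using assms(1) unfolding n_def by linarith
  then obtain W where W: "W \<subseteq> V - U" "card W = 2 * n mod 3" by (metis obtain_subset_with_card_n)
  define \<tau> :: "'a \<Rightarrow> int" where "\<tau> v = (if v \<in> W then 2 else 1)" for v
  have "sum \<tau> (V - U) = (\<Sum>v\<in>V-U. 1 + (if v \<in> W then 1 else 0))"
    by (intro sum.cong refl) (simp add: \<tau>_def)
  also have "\<dots> = int n + int (card W)"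
    using W fin by (simp add: sum.distrib n_def sum.inter_restrict[symmetric] Int_absorb1)
  also have "\<dots> = int (n + 2 * n mod 3)" using W by simp
  finally have "sum \<tau> (V - U) = int (n + 2 * n mod 3)" .
  moreover have "3 dvd (n + 2 * n mod 3)" by presburger
  ultimately have "3 dvd sum \<tau> (V - U)" by presburger
  then show ?thesis
    using no_edge U_V \<rho>_U U_indep conB
    by (intro distinguishing_mod3[of U \<rho> \<tau>]) (auto simp: \<tau>_def)
qed

text \<open>Domination leaves each vertex outside \<open>U\<close> at most one neighbour outside
  \<open>U\<close>, so the edges there form a matching. An orientation marks one end of each for the
  target 2; the other end gets 1.\<close>

lemma distinguishing_if_cycle:
  assumes "d = 2" and ab: "a \<notin> U" "b \<notin> U" "E a b"
  shows "\<exists>x. distinguishing x"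
proof -
  obtain I where I: "\<forall>u\<in>V. \<forall>w\<in>V. E u w \<longrightarrow> I u w \<noteq> I w u \<and>
      0 + 2 * int (card {x\<in>V. E u x \<and> I u x}) \<noteq> 0 + 2 * int (card {x\<in>V. E w x \<and> I w x})"
    using proper_orientation[OF fin symp_E irreflp_E, of "\<lambda>_. 0"] by (elim exE)
  have uniq: "w = w'" if w: "u \<notin> U" "w \<notin> U" "w' \<notin> U" "E u w" "E u w'" for u w w'
  proof (rule ccontr)
    assume "w \<noteq> w'"
    obtain t where t: "t \<in> U" "E u t" using U_dom[of u] E_V w by blast
    have "t \<noteq> w" "t \<noteq> w'" using t w by blast+
    then have "card {t, w, w'} = 3" using \<open>w \<noteq> w'\<close> by simp
    moreover have "{t, w, w'} \<subseteq> {x\<in>V. E u x}" using w t E_V2 by blast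
    then have "card {t, w, w'} \<le> 2"
      using card_mono[of "{x\<in>V. E u x}" "{t, w, w'}"] deg[OF E_V[OF w(4)]] fin assms(1) by simp
    ultimately show False by simp
  qed
  define \<tau> :: "'a \<Rightarrow> int" where "\<tau> u = (if \<exists>w. w \<notin> U \<and> E u w \<and> I u w then 2 else 1)" for u
  have \<tau>_eq: "\<tau> u = (if I u w then 2 else 1)" if "u \<notin> U" "w \<notin> U" "E u w" for u w
  proof -
    have "(\<exists>w'. w' \<notin> U \<and> E u w' \<and> I u w') \<longleftrightarrow> I u w" using that uniq[of u w] by blast
    then show ?thesis by (simp add: \<tau>_def)
  qed
  have "\<tau> u \<noteq> \<tau> w" if "u \<notin> U" "w \<notin> U" "E u w" for u w
    using \<tau>_eq[OF that] \<tau>_eq[OF that(2,1) E_sym[OF that(3)]] that(3)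
      bspec[OF bspec[OF I E_V[OF that(3)]] E_V2[OF that(3)]] by auto
  moreover have "\<tau> v = 1 \<or> \<tau> v = 2" for v by (simp add: \<tau>_def)
  ultimately show ?thesis
    using ab U_V \<rho>_U U_indep conB by (intro distinguishing_mod3[of U \<rho> \<tau>]) blast+
qed

text \<open>The exceptional vertex is a farthest element of \<open>S\<close>, which contains
  \<open>a\<close>. Domination gives it a neighbour in \<open>U\<close>, so the two cases for
  \<open>h r\<close> are exhaustive.\<close>

lemma distinguishing_if_odd:
  assumes "d \<ge> 3" "odd (card (V - U))" and ab: "a \<notin> U" "b \<notin> U" "E a b"
  shows "\<exists>x. distinguishing x"
proof -
  define S where "S = {v\<in>V - U. h v < d}"
  have "a \<in> S" using ab E_V h_less by (auto simp: S_def)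
  then have S: "finite S" "S \<noteq> {}" using fin by (auto simp: S_def)
  obtain r where r: "r \<in> S" "\<And>v. v \<in> S \<Longrightarrow> \<delta> v \<le> \<delta> r"
    using obtains_MAX[OF S, of \<delta>] Max_ge[of "\<delta> ` S"] S(1) by (metis finite_imageI imageI)
  have rV: "r \<in> V" "r \<notin> U" using r by (auto simp: S_def)
  have fR: "finite (V - U - {r})" using fin by simp
  obtain \<sigma> where sg: "signing (V - U - {r}) E \<sigma>"
    using ex_signing[OF fR symp_E irreflp_E] by blast
  have "card (V - U) = Suc (card (V - U - {r}))" using rV fin by (metis Diff_iff card.remove finite_Diff)
  then have ev: "even (card (V - U - {r}))" using assms(2) by simp
  interpret extremal_exceptional V E d U \<rho> r \<sigma> "V - U - {r}"
    by unfold_locales (use rV ev sg r in \<open>auto simp: S_def\<close>)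
  obtain u where "u \<in> U" "E r u" using U_dom rV by blast
  then have "h r \<noteq> 0" using fin_U by (auto simp: h_def)
  then consider "h r = 1" | "h r \<ge> 2" by linarith
  then show ?thesis
    using distinguishing_if_h_eq_1 distinguishing_if_h_ge_2 assms(1) by cases auto
qed

end

context regular_graph_on
begin

theorem ex_distinguishing:
  assumes "V \<noteq> {}" "d \<ge> 2"
  shows "\<exists>x. distinguishing x"
proof -
  obtain \<rho> where \<rho>: "\<rho> \<in> V" using assms by blast
  show ?thesis
  proof (rule connected_independent_set[OF \<rho>])
    fix U assume U: "U \<subseteq> V" "\<rho> \<in> U" "\<And>u w. u \<in> U \<Longrightarrow> w \<in> U \<Longrightarrow> \<not> E u w"
      "\<And>v. v \<in> V - U \<Longrightarrow> \<exists>u\<in>U. E v u"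
      "\<And>v. v \<in> V \<Longrightarrow> (\<lambda>u w. E u w \<and> (u \<in> U) \<noteq> (w \<in> U))\<^sup>*\<^sup>* v \<rho>"
    interpret independent_split V E d U \<rho>
      by unfold_locales (fact U)+
    show ?thesis
    proof (cases "\<exists>a b. a \<notin> U \<and> b \<notin> U \<and> E a b")
      case True
      then obtain a b where ab: "a \<notin> U" "b \<notin> U" "E a b" by blast
      consider "d = 2" | "d \<ge> 3" "even (card (V - U))" | "d \<ge> 3" "odd (card (V - U))"
        using assms(2) by linarith
      then show ?thesis
        using distinguishing_if_cycle[OF _ ab] distinguishing_even distinguishing_if_odd[OF _ _ ab] by cases auto
    next
      case False
      then show ?thesis using distinguishing_if_bipartite assms(2) by blast
    qed
  qed
qed

end

section \<open>From weightings to colourings of the doubled graph\<close>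

lemma sum_incident_edges:
  assumes "multigraph G"
  shows "(\<Sum>e | e \<in># edges G \<and> v \<in> e. f e) = (\<Sum>w | w \<in> verts G \<and> adjacent G v w. f {v, w})"
proof -
  have card2: "e \<in># edges G \<Longrightarrow> e \<subseteq> verts G \<and> card e = 2" for e
    using assms by (simp add: multigraph_def)
  have "{e. e \<in># edges G \<and> v \<in> e} = (\<lambda>w. {v, w}) ` {w. w \<in> verts G \<and> adjacent G v w}"
  proof (intro set_eqI iffI)
    fix e assume e: "e \<in> {e. e \<in># edges G \<and> v \<in> e}"
    then obtain a b where "e = {a, b}" using card2[of e] by (auto simp: card_2_iff)
    then obtain w where "e = {v, w}" using e by auto
    then show "e \<in> (\<lambda>w. {v, w}) ` {w. w \<in> verts G \<and> adjacent G v w}"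
      using e card2[of e] by (auto simp: adjacent_def)
  qed (auto simp: adjacent_def)
  moreover have "inj_on (\<lambda>w. {v, w}) {w. w \<in> verts G \<and> adjacent G v w}"
    by (auto simp: inj_on_def doubleton_eq_iff)
  ultimately show ?thesis by (simp add: sum.reindex)
qed

lemma adjacent_sym: "adjacent G u w \<Longrightarrow> adjacent G w u"
  by (simp add: adjacent_def insert_commute)

lemma degree_simple_graph:
  assumes "simple_graph G"
  shows "degree G v = card {w \<in> verts G. adjacent G v w}"
proof -
  have "count (edges G) {v, w} = 1" if "adjacent G v w" for w
  proof -
    have "count (edges G) {v, w} > 0" using that by (simp add: adjacent_def)
    moreover have "count (edges G) {v, w} \<le> 1" using assms by (simp add: simple_graph_def)
    ultimately show ?thesis by linarith
  qed
  moreover have "multigraph G" using assms by (simp add: simple_graph_def)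
  ultimately show ?thesis unfolding degree_def by (simp add: sum_incident_edges)
qed

text \<open>An edge leaving \<open>{v, w}\<close> would give \<open>w\<close> a second neighbour, so
  connectivity confines the graph to this pair. This disposes of degree one.\<close>

lemma isomorphic_complete_graph_2:
  assumes "simple_graph G" "connected_graph G" "\<And>v. v \<in> verts G \<Longrightarrow> card {w \<in> verts G. adjacent G v w} = 1"
  shows "isomorphic G (complete_graph 2)"
proof -
  have mg: "multigraph G" using assms(1) by (simp add: simple_graph_def)
  then obtain v where v: "v \<in> verts G" by (auto simp: multigraph_def)
  obtain w where w: "{w \<in> verts G. adjacent G v w} = {w}" using assms(3)[OF v] by (auto simp: card_1_singleton_iff)
  then have vw: "adjacent G v w" "w \<in> verts G" by blast+
  then have e: "{v, w} \<in># edges G" by (simp add: adjacent_def)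
  then have "card {v, w} = 2" using mg by (simp add: multigraph_def)
  then have ne: "v \<noteq> w" by auto
  have V: "verts G = {v, w}"
  proof (rule ccontr)
    assume "verts G \<noteq> {v, w}"
    then obtain y where y: "y \<in> verts G" "y \<notin> {v, w}" using v vw by blast
    then have "(adjacent G)\<^sup>*\<^sup>* v y" using assms(2) v by (simp add: connected_graph_def)
    then obtain a b where ab: "a \<in> {v, w}" "b \<notin> {v, w}" "adjacent G a b"
      using rtranclp_leaves[of "adjacent G" v y "{v, w}"] y by blast
    have "b \<in> verts G" using ab(3) mg by (auto simp: adjacent_def multigraph_def)
    have "a = w" using ab w \<open>b \<in> verts G\<close> by blast
    then have "{v, b} \<subseteq> {x \<in> verts G. adjacent G w x}"
      using ab \<open>b \<in> verts G\<close> v adjacent_sym[OF vw(1)] by auto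
    moreover have "finite (verts G)" using mg by (simp add: multigraph_def)
    ultimately have "card {v, b} \<le> 1"
      using assms(3)[OF vw(2)] card_mono[of "{x \<in> verts G. adjacent G w x}" "{v, b}"] by simp
    then show False using ab by auto
  qed
  have edges: "edges G = {#{v, w}#}"
  proof (rule multiset_eqI)
    fix f
    show "count (edges G) f = count {#{v, w}#} f"
    proof (cases "f = {v, w}")
      case True
      have "count (edges G) f \<le> 1" using assms(1) by (simp add: simple_graph_def)
      moreover have "count (edges G) f > 0" using e True by simp
      ultimately have "count (edges G) f = 1" by linarith
      then show ?thesis using True by simp
    next
      case False
      have "f \<notin># edges G"
      proof
        assume "f \<in># edges G"
        then have "f \<subseteq> {v, w}" "card f = card {v, w}" using mg V ne by (auto simp: multigraph_def)
        then show False using False card_subset_eq[of "{v, w}" f] by simp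
      qed
      then show ?thesis using False by (simp add: not_in_iff)
    qed
  qed
  have two: "{e. e \<subseteq> {..<2::nat} \<and> card e = 2} = {{..<2}}"
    using card_subset_eq[of "{..<2::nat}"] by auto
  define f where "f a = (if a = v then 0 else 1 :: nat)" for a
  have img: "f ` {v, w} = {..<2}" using ne by (auto simp: f_def)
  have "bij_betw f (verts G) (verts (complete_graph 2))"
    using img ne unfolding V by (auto simp: bij_betw_def inj_on_def complete_graph_def f_def)
  moreover have "edges (complete_graph 2) = image_mset ((`) f) (edges G)"
    unfolding edges complete_graph_def by (simp add: two img del: image_insert)
  ultimately show ?thesis unfolding isomorphic_def by blast
qed

lemma card_less_2: "card {i::nat. i < 2 \<and> P i} = of_bool (P 0) + of_bool (P 1)"
proof -
  have "{i::nat. i < 2 \<and> P i} = (if P 0 then {0} else {}) \<union> (if P 1 then {1} else {})"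
    using less_2_cases by force
  then show ?thesis by simp
qed

text \<open>In the two colour classes the degree of \<open>v\<close> is \<open>d\<close> plus,
  respectively minus, its value, so different values of neighbours make both classes locally
  irregular.\<close>

lemma lir_doubled_le_2:
  fixes G :: "'a mgraph"
  assumes G: "simple_graph G" and x: "regular_graph_on.distinguishing (verts G) (adjacent G) x"
    and loc: "regular_graph_on (verts G) (adjacent G) d"
  shows "lir (doubled G) \<le> 2"
proof -
  interpret regular_graph_on "verts G" "adjacent G" d by fact
  have mg: "multigraph G" using G by (simp add: simple_graph_def)
  have w: "weighting x" and neq: "\<And>u w. adjacent G u w \<Longrightarrow> (\<Sum>t\<in>verts G. x u t) \<noteq> (\<Sum>t\<in>verts G. x w t)"
    using x unfolding distinguishing_def by blast+
  \<comment> \<open>\<open>X\<close> is \<open>x\<close> as a function of the edge; the choice is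
    unambiguous by symmetry of \<open>x\<close>.\<close>
  define X where "X e = (SOME k. \<exists>u w. e = {u, w} \<and> k = x u w)" for e
  have X: "X {u, v} = x u v" for u v
    unfolding X_def by (rule some_equality) (use weightingD(1)[OF w] in \<open>auto simp: doubleton_eq_iff\<close>)
  \<comment> \<open>Of the copies 0 and 1 of an edge \<open>e\<close>, exactly
    \<open>1 + X e\<close> get colour 1 and \<open>1 - X e\<close> get colour 0.\<close>
  define c where "c p = (if int (snd p) < X (fst p) + 1 then 1 else 0 :: nat)" for p
  define M where "M = doubled G"
  have cM: "count (edges M) e = 2 * count (edges G) e" for e by (simp add: M_def doubled_def)
  have cnt: "int (count (edges (colour_class M c k)) {u, v}) = (if k = 1 then 1 + x u v else 1 - x u v)"
    if uv: "adjacent G u v" and k: "k \<in> {0, 1}" for u v k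
  proof -
    have "count (edges G) {u, v} > 0" "count (edges G) {u, v} \<le> 1"
      using uv G by (simp_all add: adjacent_def simple_graph_def)
    then have "count (edges M) {u, v} = 2" unfolding cM by linarith
    then have "count (edges (colour_class M c k)) {u, v} = card {i. i < 2 \<and> c ({u, v}, i) = k}"
      by (simp add: edges_colour_class)
    then have *: "count (edges (colour_class M c k)) {u, v} = of_bool (c ({u, v}, 0) = k) + of_bool (c ({u, v}, 1) = k)"
      using card_less_2[of "\<lambda>i. c ({u, v}, i) = k"] by simp
    have "x u v = -1 \<or> x u v = 0 \<or> x u v = 1" using weightingD(3)[OF w, of u v] by linarith
    then show ?thesis unfolding * using k by (auto simp: c_def X)
  qed
  have cc_sub: "e \<in># edges G" if "e \<in># edges (colour_class M c k)" for e k
  proof (rule ccontr)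
    assume "e \<notin># edges G"
    then have "count (edges M) e = 0" by (simp add: cM not_in_iff)
    then have "count (edges (colour_class M c k)) e = 0" by (simp add: edges_colour_class)
    then show False using that by (simp add: not_in_iff[symmetric])
  qed
  have dg: "int (degree (colour_class M c k) v)
      = int d + (if k = 1 then 1 else -1) * (\<Sum>t\<in>verts G. x v t)" if k: "k \<in> {0, 1}" and v: "v \<in> verts G" for k v
  proof -
    have "degree (colour_class M c k) v = (\<Sum>e | e \<in># edges G \<and> v \<in> e. count (edges (colour_class M c k)) e)"
      unfolding degree_def
    proof (rule sum.mono_neutral_left)
      show "finite {e. e \<in># edges G \<and> v \<in> e}" by simp
    qed (use cc_sub in \<open>auto simp: not_in_iff\<close>)
    also have "\<dots> = (\<Sum>t | t \<in> verts G \<and> adjacent G v t. count (edges (colour_class M c k)) {v, t})"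
      by (rule sum_incident_edges[OF mg])
    finally have "int (degree (colour_class M c k) v)
        = (\<Sum>t | t \<in> verts G \<and> adjacent G v t. 1 + (if k = 1 then 1 else -1) * x v t)"
      using cnt k by simp
    also have "\<dots> = int d + (if k = 1 then 1 else -1) * (\<Sum>t | t \<in> verts G \<and> adjacent G v t. x v t)"
      using deg[OF v] by (simp add: sum.distrib sum_distrib_left)
    also have "(\<Sum>t | t \<in> verts G \<and> adjacent G v t. x v t) = (\<Sum>t\<in>verts G. x v t)"
      using fin weightingD(2)[OF w] by (intro sum.mono_neutral_left) auto
    finally show ?thesis .
  qed
  have c01: "c p \<in> {0, 1}" for p unfolding c_def by simp
  have "locally_irregular_colouring M c"
    unfolding locally_irregular_colouring_def locally_irregular_def
  proof (intro ballI allI impI)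
    fix k u v assume k: "k \<in> c ` edge_elements M" and uv: "adjacent (colour_class M c k) u v"
    have k01: "k \<in> {0, 1}" using k c01 by (elim imageE) simp
    have "{u, v} \<in># edges G" using uv cc_sub unfolding adjacent_def by blast
    then have E: "adjacent G u v" by (simp add: adjacent_def)
    have "int (degree (colour_class M c k) u) \<noteq> int (degree (colour_class M c k) v)"
      using neq[OF E] dg[OF k01 E_V[OF E]] dg[OF k01 E_V2[OF E]] by simp
    then show "degree (colour_class M c k) u \<noteq> degree (colour_class M c k) v" by auto
  qed
  moreover have "card (c ` edge_elements M) \<le> card {0, 1 :: nat}"
  proof (rule card_mono)
    show "c ` edge_elements M \<subseteq> {0, 1}" by (rule image_subsetI) (rule c01)
  qed simp
  ultimately have "lir M \<le> enat 2" unfolding lir_le_iff by (intro exI[of _ c]) simp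
  then show ?thesis by (simp add: M_def numeral_eq_enat)
qed

theorem theorem5:
  fixes G :: "'a mgraph"
  assumes "simple_graph G"
    and "connected_graph G"
    and "regular_graph G"
    and "\<not> isomorphic G (complete_graph 2)"
  shows "lir (doubled G) \<le> 2"
proof -
  have mg: "multigraph G" using assms(1) by (simp add: simple_graph_def)
  obtain d where d: "\<And>v. v \<in> verts G \<Longrightarrow> card {w \<in> verts G. adjacent G v w} = d"
    using assms(3) degree_simple_graph[OF assms(1)] by (auto simp: regular_graph_def)
  have irr: "\<not> adjacent G u u" for u
  proof
    assume "adjacent G u u"
    then have "card {u, u} = 2" using mg unfolding adjacent_def multigraph_def by blast
    then show False by simp
  qed
  have inV: "adjacent G u w \<Longrightarrow> u \<in> verts G" for u w
    using mg unfolding adjacent_def multigraph_def by blast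
  have loc: "regular_graph_on (verts G) (adjacent G) d"
  proof
    show "finite (verts G)" using mg by (simp add: multigraph_def)
    show "(adjacent G)\<^sup>*\<^sup>* u w" if "u \<in> verts G" "w \<in> verts G" for u w
      using that assms(2) by (simp add: connected_graph_def)
  qed (fact adjacent_sym irr inV d)+
  interpret regular_graph_on "verts G" "adjacent G" d by fact
  have ne: "verts G \<noteq> {}" using mg by (simp add: multigraph_def)
  have "d \<noteq> 1" using isomorphic_complete_graph_2[OF assms(1,2)] d assms(4) by auto
  then consider "d = 0" | "d \<ge> 2" by linarith
  then have "\<exists>x. distinguishing x"
  proof cases
    case 1
    have "\<not> adjacent G u w" for u w
    proof
      assume uw: "adjacent G u w"
      then have "w \<in> {w \<in> verts G. adjacent G u w}" using E_V2 by blast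
      then show False using d[OF inV[OF uw]] 1 fin by auto
    qed
    then have "distinguishing (\<lambda>_ _. 0)" by (simp add: distinguishing_def weighting_def)
    then show ?thesis by blast
  qed (use ex_distinguishing[OF ne] in blast)
  then show ?thesis using lir_doubled_le_2[OF assms(1) _ loc] by blast
qed

end
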